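(* Let $m\geqslant 22$ be an integer and let $G$ be a graph with exactly $m$ edges, no isolated vertices, containing no subgraph isomorphic to the cycle $C_5$, and with $G\not\cong S_{\frac{m+3}{2},2}$. Let $\rho_1(m)$ be the largest real zero of $\psi_1(x)=x^4-mx^2-(m-2)x+\frac{m}{2}-1$ if $m$ is even, and $\psi_1(x)=x^4-mx^2-(m-3)x+m-3$ if $m$ is odd. Then $\lambda(G)\leqslant \rho_1(m)$, with equality if and only if $G\cong S^1_{\frac{m+4}{2},2}$ when $m$ is even, and $G\cong S^2_{\frac{m+5}{2},2}$ when $m$ is odd.
   Context: All graphs are finite and simple; $\lambda(G)$ denotes the largest eigenvalue (spectral radius) of the adjacency matrix of $G$. For graphs $G,H$, the join $G\vee H$ is obtained from $G\cup H$ by adding all edges between $V(G)$ and $V(H)$. $S_{n,k}:=K_k\vee (n-k)K_1$ is the complete split graph (the excluded graph $S_{\frac{m+3}{2},2}$ exists only when $m$ is odd; for even $m$ no graph is excluded). $S^t_{n,k}$ denotes the graph obtained from $S_{n-t,k}$ by attaching $t$ pendant vertices to a vertex of maximum degree of $S_{n-t,k}$. *)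

theory Defs
  imports "Graph_Theory.Graph_Theory" "Jordan_Normal_Form.Spectral_Radius"
begin

text \<open>
  A finite simple graph is a \<^term>\<open>pair_graph\<close>: a finite vertex set together with a symmetric
  irreflexive set of arcs, so that an undirected edge \<open>uv\<close> is the pair of arcs \<open>(u, v)\<close>, \<open>(v, u)\<close>.
  Isomorphism and the subgraph relation are the ones of the Graph_Theory library, read through
  \<^term>\<open>with_proj\<close>; tails and heads being \<^term>\<open>fst\<close> and \<^term>\<open>snd\<close>, an isomorphism is exactly an
  adjacency-preserving bijection of the vertex sets (see \<open>graph_iso_iff\<close>).
\<close>

definition graph_iso :: "'a pair_pre_digraph \<Rightarrow> 'b pair_pre_digraph \<Rightarrow> bool" where
  "graph_iso G H \<longleftrightarrow> digraph_iso (with_proj G) (with_proj H)"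

definition contains_subgraph_iso_to :: "'a pair_pre_digraph \<Rightarrow> 'b pair_pre_digraph \<Rightarrow> bool" where
  "contains_subgraph_iso_to G F \<longleftrightarrow>
     (\<exists>H. subgraph (with_proj H) (with_proj G) \<and> graph_iso H F)"

definition edges :: "'a pair_pre_digraph \<Rightarrow> 'a set set" where
  "edges G = {{u, v} | u v. (u, v) \<in> parcs G}"

definition isolated :: "'a pair_pre_digraph \<Rightarrow> 'a \<Rightarrow> bool" where
  "isolated G v \<longleftrightarrow> v \<in> pverts G \<and> out_degree (with_proj G) v = 0"


subsection \<open>Graph constructions\<close>

definition complete_graph :: "nat \<Rightarrow> nat pair_pre_digraph" where
  "complete_graph n = \<lparr> pverts = {..<n}, parcs = {(i, j). i < n \<and> j < n \<and> i \<noteq> j} \<rparr>"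

text \<open>\<open>n K\<^sub>1\<close>, the disjoint union of \<open>n\<close> single vertices.\<close>

definition empty_graph :: "nat \<Rightarrow> nat pair_pre_digraph" where
  "empty_graph n = \<lparr> pverts = {..<n}, parcs = {} \<rparr>"

text \<open>Meaningful for \<open>n \<ge> 3\<close>.\<close>

definition cycle_graph :: "nat \<Rightarrow> nat pair_pre_digraph" where
  "cycle_graph n = \<lparr> pverts = {..<n},
     parcs = {(i, j). i < n \<and> j < n \<and> (j = (i + 1) mod n \<or> i = (j + 1) mod n)} \<rparr>"

definition join :: "'a pair_pre_digraph \<Rightarrow> 'b pair_pre_digraph \<Rightarrow> ('a + 'b) pair_pre_digraph" where
  "join G H = \<lparr> pverts = pverts G <+> pverts H,
     parcs = {(Inl u, Inl v) | u v. (u, v) \<in> parcs G}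
           \<union> {(Inr u, Inr v) | u v. (u, v) \<in> parcs H}
           \<union> {(Inl u, Inr v) | u v. u \<in> pverts G \<and> v \<in> pverts H}
           \<union> {(Inr v, Inl u) | u v. u \<in> pverts G \<and> v \<in> pverts H} \<rparr>"

definition attach_pendants :: "nat \<Rightarrow> 'a \<Rightarrow> 'a pair_pre_digraph \<Rightarrow> ('a + nat) pair_pre_digraph" where
  "attach_pendants t w G = \<lparr> pverts = pverts G <+> {..<t},
     parcs = {(Inl u, Inl v) | u v. (u, v) \<in> parcs G}
           \<union> {(Inl w, Inr i) | i. i < t}
           \<union> {(Inr i, Inl w) | i. i < t} \<rparr>"

definition complete_split :: "nat \<Rightarrow> nat \<Rightarrow> (nat + nat) pair_pre_digraph" where
  "complete_split n k = join (complete_graph k) (empty_graph (n - k))"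

text \<open>
  \<open>S\<^sup>t\<^bsub>n,k\<^esub>\<close>. The vertices of maximum degree of a complete split graph are equivalent under its
  automorphisms, so the isomorphism class does not depend on the one picked by
  \<^term>\<open>arg_max_on\<close>.
\<close>

definition pendant_split :: "nat \<Rightarrow> nat \<Rightarrow> nat \<Rightarrow> ((nat + nat) + nat) pair_pre_digraph" where
  "pendant_split t n k = (let S = complete_split (n - t) k in
     attach_pendants t (arg_max_on (out_degree (with_proj S)) (pverts S)) S)"


subsection \<open>The spectral radius\<close>

text \<open>The adjacency matrix with respect to an enumeration \<open>vs\<close> of the vertices.\<close>

definition adjacency_matrix :: "'a pair_pre_digraph \<Rightarrow> 'a list \<Rightarrow> real mat" where
  "adjacency_matrix G vs = mat (length vs) (length vs)
     (\<lambda>(i, j). if (vs ! i, vs ! j) \<in> parcs G then 1 else 0)"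

definition vertex_enum :: "'a pair_pre_digraph \<Rightarrow> 'a list \<Rightarrow> bool" where
  "vertex_enum G vs \<longleftrightarrow> distinct vs \<and> set vs = pverts G"

text \<open>
  The choice of the enumeration is immaterial by \<open>spectrum_adjacency_matrix_cong\<close>. The matrix is
  real symmetric, so its real eigenvalues are all its eigenvalues.
\<close>

definition largest_eigenvalue :: "'a pair_pre_digraph \<Rightarrow> real" where
  "largest_eigenvalue G = Max (spectrum (adjacency_matrix G (SOME vs. vertex_enum G vs)))"


subsection \<open>The polynomial and its largest zero\<close>

definition psi1 :: "nat \<Rightarrow> real \<Rightarrow> real" where
  "psi1 m x =
     (if even m then x ^ 4 - real m * x ^ 2 - (real m - 2) * x + real m / 2 - 1
      else x ^ 4 - real m * x ^ 2 - (real m - 3) * x + real m - 3)"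

definition rho1 :: "nat \<Rightarrow> real" where
  "rho1 m = Max {x. psi1 m x = 0}"


subsection \<open>Well-definedness\<close>

lemma graph_iso_iff:
  assumes "pair_wf_digraph G" "pair_wf_digraph H"
  shows "graph_iso G H \<longleftrightarrow> (\<exists>f. bij_betw f (pverts G) (pverts H) \<and>
    (\<forall>u \<in> pverts G. \<forall>v \<in> pverts G. (u, v) \<in> parcs G \<longleftrightarrow> (f u, f v) \<in> parcs H))"
    (is "_ \<longleftrightarrow> ?R")
proof
  assume "graph_iso G H"
  then obtain h where h: "pre_digraph.digraph_isomorphism (with_proj G) h"
    and H: "with_proj H = app_iso h (with_proj G)"
    unfolding graph_iso_def digraph_iso_def by blast
  let ?f = "iso_verts h"
  from h have inj: "inj_on ?f (pverts G)"
    by (simp add: pre_digraph.digraph_isomorphism_def)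
  from H have V: "pverts H = ?f ` pverts G" and A: "parcs H = iso_arcs h ` parcs G"
    and T: "iso_tail h = fst" "iso_head h = snd"
    by (simp_all add: app_iso_def with_proj_def)
  have arc: "iso_arcs h a = (?f (fst a), ?f (snd a))" if "a \<in> parcs G" for a
    using h that T by (simp add: pre_digraph.digraph_isomorphism_def prod_eq_iff)
  have "(u, v) \<in> parcs G \<longleftrightarrow> (?f u, ?f v) \<in> parcs H" if "u \<in> pverts G" "v \<in> pverts G" for u v
  proof
    assume "(u, v) \<in> parcs G"
    then show "(?f u, ?f v) \<in> parcs H" using A arc[of "(u, v)"] by (metis fst_conv imageI snd_conv)
  next
    assume "(?f u, ?f v) \<in> parcs H"
    then obtain a where a: "a \<in> parcs G" "(?f u, ?f v) = iso_arcs h a" using A by auto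
    then have "?f u = ?f (fst a)" "?f v = ?f (snd a)" using arc[OF a(1)] by simp_all
    moreover have "fst a \<in> pverts G" "snd a \<in> pverts G"
      using pair_wf_digraph.arc_fst_in_verts[OF assms(1) a(1)]
        pair_wf_digraph.arc_snd_in_verts[OF assms(1) a(1)] by simp_all
    ultimately have "u = fst a" "v = snd a"
      using inj_onD[OF inj] that by blast+
    then show "(u, v) \<in> parcs G" using a by simp
  qed
  moreover have "bij_betw ?f (pverts G) (pverts H)" using inj V unfolding bij_betw_def by simp
  ultimately show ?R by blast
next
  assume ?R
  then obtain f where f: "inj_on f (pverts G)" "f ` pverts G = pverts H"
    and e: "\<And>u v. u \<in> pverts G \<Longrightarrow> v \<in> pverts G \<Longrightarrow> (u, v) \<in> parcs G \<longleftrightarrow> (f u, f v) \<in> parcs H"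
    unfolding bij_betw_def by auto
  let ?h = "\<lparr> iso_verts = f, iso_arcs = \<lambda>a. (f (fst a), f (snd a)),
    iso_head = snd, iso_tail = fst \<rparr>"
  have wf: "wf_digraph (with_proj G)" using assms(1) by (simp add: wf_digraph_wp_iff)
  have G: "fst a \<in> pverts G" "snd a \<in> pverts G" if "a \<in> parcs G" for a
    using pair_wf_digraph.arc_fst_in_verts[OF assms(1) that]
      pair_wf_digraph.arc_snd_in_verts[OF assms(1) that] by simp_all
  have H: "fst a \<in> pverts H" "snd a \<in> pverts H" if "a \<in> parcs H" for a
    using pair_wf_digraph.arc_fst_in_verts[OF assms(2) that]
      pair_wf_digraph.arc_snd_in_verts[OF assms(2) that] by simp_all
  have "inj_on (\<lambda>a. (f (fst a), f (snd a))) (parcs G)"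
    by (rule inj_onI) (use inj_onD[OF f(1)] G in \<open>simp add: prod_eq_iff\<close>)
  then have "pre_digraph.digraph_isomorphism (with_proj G) ?h"
    using wf f(1) by (simp add: pre_digraph.digraph_isomorphism_def)
  moreover have "parcs H = (\<lambda>a. (f (fst a), f (snd a))) ` parcs G"
  proof (intro equalityI subsetI)
    fix b assume b: "b \<in> parcs H"
    have "fst b \<in> f ` pverts G" "snd b \<in> f ` pverts G" using H[OF b] f(2) by simp_all
    then obtain u v where uv: "u \<in> pverts G" "v \<in> pverts G" "fst b = f u" "snd b = f v" by blast
    then have "b = (f u, f v)" by (simp add: prod_eq_iff)
    moreover from this have "(u, v) \<in> parcs G" using e[OF uv(1,2)] b by simp
    ultimately show "b \<in> (\<lambda>a. (f (fst a), f (snd a))) ` parcs G" by force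
  next
    fix b assume "b \<in> (\<lambda>a. (f (fst a), f (snd a))) ` parcs G"
    then obtain a where a: "a \<in> parcs G" "b = (f (fst a), f (snd a))" by blast
    then show "b \<in> parcs H" using e[OF G[OF a(1)]] by simp
  qed
  ultimately show "graph_iso G H"
    using f(2) unfolding graph_iso_def digraph_iso_def
    by (intro exI[of _ ?h]) (simp add: app_iso_def with_proj_def)
qed

lemma pair_graph_iff:
  "pair_graph G \<longleftrightarrow> finite (pverts G) \<and> parcs G \<subseteq> pverts G \<times> pverts G \<and>
    sym (parcs G) \<and> (\<forall>v. (v, v) \<notin> parcs G)" (is "?L \<longleftrightarrow> ?R")
proof
  assume ?L
  then interpret pair_graph G .
  have "sym (parcs G)" using pair_sym_arcs by (simp add: symmetric_def)
  moreover have "(v, v) \<notin> parcs G" for v using pair_no_loops[of "(v, v)"] by auto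
  moreover have "parcs G \<subseteq> pverts G \<times> pverts G" using in_arcsD1 in_arcsD2 by auto
  ultimately show ?R using pair_finite_verts by blast
next
  assume R: ?R
  then have "finite (parcs G)" by (meson finite_SigmaI finite_subset)
  moreover have "arcs_ends (with_proj G) = parcs G"
    by (simp add: arcs_ends_def arc_to_ends_def)
  then have "symmetric (with_proj G)" using R by (simp add: symmetric_def)
  moreover have "fst e \<in> pverts G" "snd e \<in> pverts G" "fst e \<noteq> snd e" if "e \<in> parcs G" for e
    using R that by (cases e, auto)+
  ultimately show ?L using R by unfold_locales blast+
qed

lemma pair_graph_complete_split: "pair_graph (complete_split n k)"
  unfolding pair_graph_iff complete_split_def join_def complete_graph_def empty_graph_def
  unfolding sym_def by auto

lemma pair_graph_attach_pendants:
  assumes "pair_graph G" "w \<in> pverts G"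
  shows "pair_graph (attach_pendants t w G)"
  using assms unfolding pair_graph_iff attach_pendants_def sym_def by auto

lemma pair_graph_pendant_split:
  assumes "t < n"
  shows "pair_graph (pendant_split t n k)"
proof -
  let ?S = "complete_split (n - t) k"
  have "finite (pverts ?S)" "pverts ?S \<noteq> {}"
    using assms by (auto simp: complete_split_def join_def complete_graph_def empty_graph_def
        lessThan_empty_iff)
  then obtain x where x: "x \<in> pverts ?S" by blast
  have "arg_max (out_degree (with_proj ?S)) (\<lambda>x. x \<in> pverts ?S) \<in> pverts ?S"
  proof (rule arg_max_natI)
    show "x \<in> pverts ?S" by (rule x)
    show "\<forall>y. y \<in> pverts ?S \<longrightarrow> out_degree (with_proj ?S) y
        < Suc (Max (out_degree (with_proj ?S) ` pverts ?S))"
      using \<open>finite (pverts ?S)\<close> by (auto simp: less_Suc_eq_le)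
  qed
  then have "arg_max_on (out_degree (with_proj ?S)) (pverts ?S) \<in> pverts ?S"
    by (simp add: arg_max_on_def)
  then show ?thesis
    by (simp add: pendant_split_def Let_def pair_graph_attach_pendants pair_graph_complete_split)
qed

lemma spectrum_adjacency_matrix:
  assumes "vertex_enum G vs"
  shows "spectrum (adjacency_matrix G vs) = {l. \<exists>x. (\<exists>u \<in> pverts G. x u \<noteq> 0) \<and>
    (\<forall>u \<in> pverts G. (\<Sum>v \<in> {v \<in> pverts G. (u, v) \<in> parcs G}. x v) = l * x u)}"
    (is "_ = {l. ?P l}")
proof -
  let ?n = "length vs" and ?A = "adjacency_matrix G vs"
  have d: "distinct vs" and s: "set vs = pverts G" using assms by (auto simp: vertex_enum_def)
  have fin: "finite (pverts G)" using s by (metis finite_set)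
  have dimA: "dim_row ?A = ?n" "dim_col ?A = ?n" by (simp_all add: adjacency_matrix_def)
  have mult: "(?A *\<^sub>v vec ?n (\<lambda>i. x (vs ! i))) $ i
      = (\<Sum>v \<in> {v \<in> pverts G. (vs ! i, v) \<in> parcs G}. x v)" if "i < ?n" for i and x :: "_ \<Rightarrow> real"
  proof -
    have "(?A *\<^sub>v vec ?n (\<lambda>i. x (vs ! i))) $ i
        = (\<Sum>j<?n. (if (vs ! i, vs ! j) \<in> parcs G then x (vs ! j) else 0))"
      using that
      by (auto simp: adjacency_matrix_def scalar_prod_def lessThan_atLeast0 intro!: sum.cong)
    also have "\<dots> = (\<Sum>v \<in> pverts G. (if (vs ! i, v) \<in> parcs G then x v else 0))"
      by (rule sum.reindex_bij_betw[OF bij_betw_nth[OF d refl s[symmetric]]])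
    finally show ?thesis using fin by (simp add: sum.If_cases Int_def)
  qed
  have "eigenvalue ?A l \<longleftrightarrow> ?P l" for l
  proof
    assume "eigenvalue ?A l"
    then obtain y where y: "y \<in> carrier_vec ?n" "y \<noteq> 0\<^sub>v ?n" "?A *\<^sub>v y = l \<cdot>\<^sub>v y"
      unfolding eigenvalue_def eigenvector_def dimA by blast
    define x where "x u = y $ (THE i. i < ?n \<and> vs ! i = u)" for u
    have x: "x (vs ! i) = y $ i" if "i < ?n" for i
      unfolding x_def by (rule arg_cong[of _ _ "\<lambda>i. y $ i"], rule the_equality)
        (use that d in \<open>auto simp: nth_eq_iff_index_eq\<close>)
    have yx: "y = vec ?n (\<lambda>i. x (vs ! i))" using y(1) x by (intro eq_vecI) auto
    obtain i where "i < ?n" "y $ i \<noteq> 0" using y(1,2) by (metis carrier_vecD eq_vecI index_zero_vec)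
    then have "\<exists>u \<in> pverts G. x u \<noteq> 0" using x s by (metis nth_mem)
    moreover have "(\<Sum>v \<in> {v \<in> pverts G. (u, v) \<in> parcs G}. x v) = l * x u"
      if u: "u \<in> pverts G" for u
    proof -
      obtain i where i: "i < ?n" "vs ! i = u" using u s by (metis in_set_conv_nth)
      have "(?A *\<^sub>v y) $ i = l * y $ i" using y i by simp
      then show ?thesis using mult[OF i(1), of x] x[OF i(1)] i yx by simp
    qed
    ultimately show "?P l" by blast
  next
    assume "?P l"
    then obtain x u where u: "u \<in> pverts G" "x u \<noteq> 0"
      and e: "\<And>u. u \<in> pverts G \<Longrightarrow> (\<Sum>v \<in> {v \<in> pverts G. (u, v) \<in> parcs G}. x v) = l * x u" by blast
    let ?y = "vec ?n (\<lambda>i. x (vs ! i))"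
    obtain i where i: "i < ?n" "vs ! i = u" using u s by (metis in_set_conv_nth)
    have "?y \<noteq> 0\<^sub>v ?n" using i u(2) by (metis index_vec index_zero_vec(1))
    moreover have "?A *\<^sub>v ?y = l \<cdot>\<^sub>v ?y"
    proof (rule eq_vecI)
      fix j assume "j < dim_vec (l \<cdot>\<^sub>v ?y)"
      then have j: "j < ?n" by simp
      then have "vs ! j \<in> pverts G" using s by (metis nth_mem)
      then show "(?A *\<^sub>v ?y) $ j = (l \<cdot>\<^sub>v ?y) $ j" using mult[OF j, of x] e j by simp
    qed (simp add: dimA)
    ultimately show "eigenvalue ?A l"
      unfolding eigenvalue_def eigenvector_def dimA by (intro exI[of _ ?y]) auto
  qed
  then show ?thesis unfolding spectrum_def by auto
qed

lemma spectrum_adjacency_matrix_cong: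
  assumes "vertex_enum G vs" "vertex_enum G ws"
  shows "spectrum (adjacency_matrix G vs) = spectrum (adjacency_matrix G ws)"
  using assms by (simp add: spectrum_adjacency_matrix)

lemma finite_zeros_psi1: "finite {x. psi1 m x = 0}"
proof -
  let ?p = "if even m then [:real m / 2 - 1, - (real m - 2), - real m, 0, 1:]
    else [:real m - 3, - (real m - 3), - real m, 0, 1:]"
  have "psi1 m x = poly ?p x" for x
    by (simp add: psi1_def algebra_simps power2_eq_square power4_eq_xxxx)
  moreover have "?p \<noteq> 0" by simp
  ultimately show ?thesis using poly_roots_finite[of ?p] by presburger
qed

lemma zeros_psi1_nonempty:
  assumes "m \<ge> 22"
  shows "{x. psi1 m x = 0} \<noteq> {}"
proof -
  have "\<exists>x \<ge> 1. x \<le> real m \<and> psi1 m x = 0"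
  proof (rule IVT')
    show "psi1 m 1 \<le> 0" using assms by (simp add: psi1_def)
    define r where "r = real m"
    have r: "r \<ge> 22" using assms by (simp add: r_def)
    have 2: "22 * r \<le> r * r" using r by (intro mult_right_mono) auto
    have 3: "22 * (r * r) \<le> r * (r * r)" using r by (intro mult_right_mono) auto
    have 4: "22 * (r * (r * r)) \<le> r * (r * (r * r))" using r by (intro mult_right_mono) auto
    have "0 \<le> r ^ 4 - r * r ^ 2 - (r - 2) * r + r / 2 - 1"
      "0 \<le> r ^ 4 - r * r ^ 2 - (r - 3) * r + r - 3"
      unfolding power2_eq_square power4_eq_xxxx left_diff_distrib mult.assoc
      using r 2 3 4 by linarith+
    then show "0 \<le> psi1 m (real m)" by (simp add: psi1_def r_def)
    show "1 \<le> real m" using assms by simp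
    have "continuous_on {1..real m} (\<lambda>x. x ^ 4 - real m * x ^ 2 - (real m - 2) * x + real m / 2 - 1)"
      "continuous_on {1..real m} (\<lambda>x. x ^ 4 - real m * x ^ 2 - (real m - 3) * x + real m - 3)"
      by (intro continuous_intros)+
    then show "continuous_on {1..real m} (psi1 m)" unfolding psi1_def by (cases "even m") simp_all
  qed
  then show ?thesis by blast
qed

end

theory Submission
  imports Defs "HOL-Analysis.Function_Topology"
begin

text \<open>
  Let \<open>x\<close> be a nonnegative eigenvector for \<open>\<lambda> = \<lambda>(G)\<close> with maximal entry \<open>x\<^sub>u = 1\<close>, let \<open>A\<close> be the
  neighbourhood of \<open>u\<close> and \<open>B\<close> the remaining vertices. Counting edges and expanding \<open>\<lambda>\<^sup>2 x\<^sub>u - \<lambda> x\<^sub>u\<close>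
  writes \<open>m - \<lambda>\<^sup>2 + \<lambda>\<close> as a sum of contributions of the components of \<open>G[A]\<close>, of the edges inside \<open>B\<close>
  and of the edges between \<open>A\<close> and \<open>B\<close>. If \<open>\<lambda> \<ge> \<rho>\<^sub>1(m)\<close>, this total is less than \<open>2\<close>, and less than
  \<open>3/2\<close> for even \<open>m\<close>. As \<open>G\<close> has no \<open>C\<^sub>5\<close>, \<open>G[A]\<close> has no path on four vertices, so its components
  are triangles, stars and isolated vertices. A triangle, together with its neighbours in \<open>B\<close>, costs
  at least \<open>2\<close> and a star at least \<open>1\<close>, while a graph without edges in \<open>A\<close> has \<open>\<lambda>\<^sup>2 \<le> m\<close>; hence there
  is exactly one star, and what is left of the total forces \<open>B\<close> to be empty. Thus
  \<open>G = S\<^sup>t\<^bsub>n,2\<^esub>\<close> for some \<open>t \<equiv> m + 1 (mod 2)\<close>, and comparing the quartic equation of \<open>\<lambda>\<close> with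
  \<open>\<psi>\<^sub>1\<close> rules out every \<open>t > 2\<close>, while \<open>t = 0\<close> is the excluded graph.
\<close>

subsection \<open>A nonnegative eigenvector for the largest eigenvalue\<close>

definition nbrs :: "'a set \<Rightarrow> ('a \<times> 'a) set \<Rightarrow> 'a \<Rightarrow> 'a set" where
  "nbrs S E v = {y \<in> S. (v, y) \<in> E}"

lemma finite_nbrs [simp]: "finite S \<Longrightarrow> finite (nbrs S E v)"
  by (simp add: nbrs_def)

lemma in_nbrs [simp]: "y \<in> nbrs S E v \<longleftrightarrow> y \<in> S \<and> (v, y) \<in> E"
  by (simp add: nbrs_def)

lemma sum_nbrs:
  fixes f :: "'a \<Rightarrow> 'b::comm_monoid_add"
  shows "finite S \<Longrightarrow> sum f (nbrs S E v) = (\<Sum>y\<in>S. if (v, y) \<in> E then f y else 0)"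
  by (simp only: nbrs_def sum.inter_filter)

lemma sum_nbrs_swap:
  fixes f :: "'a \<Rightarrow> 'a \<Rightarrow> 'b::comm_monoid_add"
  assumes "finite S" "finite T" "sym E"
  shows "(\<Sum>v\<in>S. \<Sum>y\<in>nbrs T E v. f v y) = (\<Sum>y\<in>T. \<Sum>v\<in>nbrs S E y. f v y)"
proof -
  have "(\<Sum>v\<in>S. \<Sum>y\<in>nbrs T E v. f v y) = (\<Sum>v\<in>S. \<Sum>y\<in>T. if (v, y) \<in> E then f v y else 0)"
    by (simp only: sum_nbrs[OF \<open>finite T\<close>])
  also have "\<dots> = (\<Sum>y\<in>T. \<Sum>v\<in>S. if (v, y) \<in> E then f v y else 0)"
    by (rule sum.swap)
  also have "\<dots> = (\<Sum>y\<in>T. \<Sum>v\<in>nbrs S E y. f v y)"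
  proof (rule sum.cong[OF refl])
    fix y
    have "(v, y) \<in> E \<longleftrightarrow> (y, v) \<in> E" for v using symD[OF \<open>sym E\<close>] by blast
    then show "(\<Sum>v\<in>S. if (v, y) \<in> E then f v y else 0) = (\<Sum>v\<in>nbrs S E y. f v y)"
      by (simp only: sum_nbrs[OF \<open>finite S\<close>])
  qed
  finally show ?thesis .
qed

text \<open>The linear term dominates for small \<open>e\<close>: at \<open>e = - a / c\<close> with
  \<open>c > 0\<close> and \<open>c > b\<close> the quadratic equals
  \<open>(a / c)^2 * (b - 2 * c)\<close>, which is negative unless \<open>a = 0\<close>.\<close>

lemma quadratic_nonneg_imp_linear_zero:
  fixes a b :: real
  assumes "\<And>e. 0 \<le> 2 * e * a + e\<^sup>2 * b"
  shows "a = 0"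
proof (rule ccontr)
  assume a: "a \<noteq> 0"
  define c where "c = \<bar>b\<bar> + 1"
  have c: "c > 0" "b < c" by (auto simp: c_def)
  have "0 \<le> 2 * (- a / c) * a + (- a / c)\<^sup>2 * b" by (rule assms)
  also have "\<dots> = (a / c)\<^sup>2 * (b - 2 * c)"
    using c by (simp add: field_simps power2_eq_square)
  also have "\<dots> < 0"
    using a c by (intro mult_pos_neg) auto
  finally show False by simp
qed

text \<open>The quadratic form of \<open>E\<close> is maximised over the nonnegative part of the
  unit sphere. Taking absolute values never decreases the form, so the maximum bounds the Rayleigh
  quotient of every vector; the eigenvalue equation is then the first-order condition at the
  maximiser.\<close>

lemma rayleigh_maximizer:
  fixes V :: "'a set" and E :: "('a \<times> 'a) set"
  assumes fin: "finite V" and ne: "V \<noteq> {}" and "sym E" and irr: "\<And>v. (v, v) \<notin> E"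
  obtains x :: "'a \<Rightarrow> real" and l where
    "\<And>v. x v \<ge> 0" "\<exists>v\<in>V. x v > 0"
    "\<And>v. v \<in> V \<Longrightarrow> (\<Sum>y\<in>nbrs V E v. x y) = l * x v"
    "\<And>z :: 'a \<Rightarrow> real. (\<Sum>v\<in>V. \<Sum>y\<in>nbrs V E v. z v * z y) \<le> l * (\<Sum>v\<in>V. (z v)\<^sup>2)"
proof -
  define Q where "Q z = (\<Sum>v\<in>V. \<Sum>y\<in>nbrs V E v. z v * z y)" for z :: "'a \<Rightarrow> real"
  define n where "n z = (\<Sum>v\<in>V. (z v)\<^sup>2)" for z :: "'a \<Rightarrow> real"
  \<comment> \<open>Vectors are functions on the whole type. Pinning the coordinates outside
    \<open>V\<close> to \<open>0\<close> puts \<open>K\<close> inside a product of compact sets, so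
    Tychonoff's theorem gives compactness.\<close>
  define K where "K = (\<Pi>\<^sub>E v\<in>UNIV. if v \<in> V then {0..1::real} else {0}) \<inter> {z. n z = 1}"
  have "compactin (product_topology (\<lambda>_. euclidean) UNIV)
      (\<Pi>\<^sub>E v\<in>UNIV. if v \<in> V then {0..1::real} else {0})"
    unfolding compactin_PiE by auto
  then have "compact (\<Pi>\<^sub>E v\<in>UNIV. if v \<in> V then {0..1::real} else {0})"
    by (simp add: euclidean_product_topology)
  moreover have "closed {z. n z = 1}"
    unfolding n_def by (intro closed_Collect_eq continuous_intros) auto
  ultimately have cK: "compact K" unfolding K_def by (rule compact_Int_closed)
  obtain v0 where v0: "v0 \<in> V" using ne by blast
  have "n (\<lambda>v. if v = v0 then 1 else 0) = (\<Sum>v\<in>V. if v = v0 then 1 else 0)"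
    unfolding n_def by (intro sum.cong) auto
  then have "(\<lambda>v. if v = v0 then 1 else 0) \<in> K"
    using v0 fin by (auto simp: K_def)
  then have "K \<noteq> {}" by blast
  moreover have "continuous_on K Q"
    unfolding Q_def
    by (intro continuous_intros; rule continuous_on_subset[OF continuous_on_product_coordinates]) simp_all
  ultimately obtain x where x: "x \<in> K" and mx: "\<And>z. z \<in> K \<Longrightarrow> Q z \<le> Q x"
    using continuous_attains_sup[OF cK] by blast
  have nx: "n x = 1" using x by (simp add: K_def)
  have x0: "x v \<ge> 0" for v
  proof -
    have "x v \<in> (if v \<in> V then {0..1} else {0})" using x by (auto simp: K_def PiE_def Pi_def)
    then show ?thesis by (auto split: if_splits)
  qed
  define l where "l = Q x"
  have ray: "Q z \<le> l * n z" for z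
  proof (cases "n z = 0")
    case True
    then have "\<forall>v\<in>V. z v = 0"
      unfolding n_def using fin by (simp add: sum_nonneg_eq_0_iff)
    then have "Q z = 0" unfolding Q_def by (intro sum.neutral ballI) auto
    then show ?thesis using True by simp
  next
    case False
    then have pos: "n z > 0" unfolding n_def by (simp add: less_le sum_nonneg)
    \<comment> \<open>The normalised absolute value of \<open>z\<close>, cut off outside
      \<open>V\<close> so that it lies in \<open>K\<close>.\<close>
    define w where "w v = (if v \<in> V then \<bar>z v\<bar> / sqrt (n z) else 0)" for v
    have nw: "n w = 1"
    proof -
      have "n w = (\<Sum>v\<in>V. (z v)\<^sup>2 / n z)"
        unfolding n_def[of w] w_def using pos by (intro sum.cong) (auto simp: power_divide)
      also have "\<dots> = n z / n z" by (simp only: n_def[of z] sum_divide_distrib)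
      finally show ?thesis using pos by simp
    qed
    have "w v \<le> 1" if "v \<in> V" for v
    proof -
      have "(w v)\<^sup>2 \<le> n w" unfolding n_def by (rule member_le_sum) (use fin that in auto)
      then have "\<bar>w v\<bar> \<le> 1" using nw abs_square_le_1[of "w v"] by simp
      then show ?thesis by simp
    qed
    then have "w \<in> K" using nw pos by (auto simp: K_def w_def)
    then have "Q w \<le> l" using mx by (simp add: l_def)
    have "Q z \<le> (\<Sum>v\<in>V. \<Sum>y\<in>nbrs V E v. \<bar>z v\<bar> * \<bar>z y\<bar>)"
      unfolding Q_def by (intro sum_mono) (metis abs_ge_self abs_mult)
    also have "\<dots> = (\<Sum>v\<in>V. \<Sum>y\<in>nbrs V E v. n z * (w v * w y))"
      using pos by (intro sum.cong) (auto simp: w_def)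
    also have "\<dots> = n z * Q w" by (simp add: Q_def sum_distrib_left)
    also have "\<dots> \<le> n z * l" using \<open>Q w \<le> l\<close> pos by simp
    finally show ?thesis by (simp add: mult.commute)
  qed
  have eig: "(\<Sum>y\<in>nbrs V E u. x y) = l * x u" if u: "u \<in> V" for u
  proof -
    let ?s = "\<Sum>y\<in>nbrs V E u. x y"
    \<comment> \<open>Perturbation of \<open>x\<close> in the single coordinate \<open>u\<close>. As
      \<open>E\<close> has no loops, \<open>Q\<close> changes linearly in \<open>e\<close>.\<close>
    define d where "d v = (if v = u then 1 else 0::real)" for v
    have n': "n (\<lambda>v. x v + e * d v) = 1 + 2 * e * x u + e\<^sup>2" for e
    proof -
      have "n (\<lambda>v. x v + e * d v) = (\<Sum>v\<in>V. (x v)\<^sup>2 + (if v = u then 2 * e * x u + e\<^sup>2 else 0))"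
        unfolding n_def d_def by (intro sum.cong) (auto simp: power2_eq_square algebra_simps)
      also have "\<dots> = n x + (2 * e * x u + e\<^sup>2)"
        unfolding n_def sum.distrib using u fin by simp
      finally show ?thesis using nx by simp
    qed
    have dn: "(\<Sum>y\<in>nbrs V E v. d y) = (if (u, v) \<in> E then 1 else 0)" for v
      using u fin symD[OF \<open>sym E\<close>] by (auto simp: d_def nbrs_def)
    have Q': "Q (\<lambda>v. x v + e * d v) = Q x + 2 * e * ?s" for e
    proof -
      have "Q (\<lambda>v. x v + e * d v) = (\<Sum>v\<in>V. \<Sum>y\<in>nbrs V E v. x v * x y + e * (d v * x y) + e * (x v * d y))"
        unfolding Q_def
      proof (intro sum.cong refl)
        fix v y assume "y \<in> nbrs V E v"
        then have "d v * d y = 0" using irr by (auto simp: d_def)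
        then show "(x v + e * d v) * (x y + e * d y) = x v * x y + e * (d v * x y) + e * (x v * d y)"
          by (simp add: algebra_simps)
      qed
      also have "\<dots> = Q x + e * (\<Sum>v\<in>V. d v * (\<Sum>y\<in>nbrs V E v. x y))
           + e * (\<Sum>v\<in>V. x v * (\<Sum>y\<in>nbrs V E v. d y))"
        by (simp add: sum.distrib Q_def sum_distrib_left)
      also have "(\<Sum>v\<in>V. d v * (\<Sum>y\<in>nbrs V E v. x y)) = ?s"
      proof -
        have "(\<Sum>v\<in>V. d v * (\<Sum>y\<in>nbrs V E v. x y)) = (\<Sum>v\<in>V. if v = u then ?s else 0)"
          unfolding d_def by (intro sum.cong) auto
        then show ?thesis using u fin by simp
      qed
      also have "(\<Sum>v\<in>V. x v * (\<Sum>y\<in>nbrs V E v. d y)) = ?s"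
      proof -
        have "(\<Sum>v\<in>V. x v * (\<Sum>y\<in>nbrs V E v. d y)) = (\<Sum>v\<in>V. if (u, v) \<in> E then x v else 0)"
          unfolding dn by (intro sum.cong) auto
        then show ?thesis by (simp only: sum_nbrs[OF fin])
      qed
      finally show ?thesis by simp
    qed
    have "0 \<le> 2 * e * (l * x u - ?s) + e\<^sup>2 * l" for e
      using ray[of "\<lambda>v. x v + e * d v"] unfolding n' Q' by (simp add: l_def algebra_simps)
    then have "l * x u - ?s = 0" by (rule quadratic_nonneg_imp_linear_zero)
    then show ?thesis by simp
  qed
  have "\<exists>v\<in>V. x v \<noteq> 0"
  proof (rule ccontr)
    assume "\<not> ?thesis"
    then have "n x = 0" unfolding n_def by (intro sum.neutral) auto
    then show False using nx by simp
  qed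
  then have "\<exists>v\<in>V. x v > 0" using x0 by (metis less_le)
  then show thesis using that[of x l] x0 eig ray by (simp add: Q_def n_def)
qed

section \<open>The largest eigenvalue in terms of functions on the vertices\<close>

lemma pair_graph_facts:
  assumes "pair_graph G"
  shows "finite (pverts G)" "sym (parcs G)" "\<And>v. (v, v) \<notin> parcs G"
    "\<And>u v. (u, v) \<in> parcs G \<Longrightarrow> u \<in> pverts G \<and> v \<in> pverts G"
  using assms unfolding pair_graph_iff by auto

text \<open>Removes the chosen vertex enumeration; the finiteness is what makes \<open>Max\<close>
  meaningful.\<close>

lemma largest_eigenvalue_alt:
  assumes "pair_graph G"
  shows "largest_eigenvalue G = Max {l. \<exists>x. (\<exists>u \<in> pverts G. x u \<noteq> 0) \<and>
    (\<forall>u \<in> pverts G. (\<Sum>v \<in> nbrs (pverts G) (parcs G) u. x v) = l * x u)}" (is ?a)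
    and "finite {l::real. \<exists>x. (\<exists>u \<in> pverts G. x u \<noteq> 0) \<and>
    (\<forall>u \<in> pverts G. (\<Sum>v \<in> nbrs (pverts G) (parcs G) u. x v) = l * x u)}" (is ?b)
proof -
  have "\<exists>vs. vertex_enum G vs"
    using finite_distinct_list[of "pverts G"] pair_graph_facts[OF assms] by (auto simp: vertex_enum_def)
  then have e: "vertex_enum G (SOME vs. vertex_enum G vs)" by (rule someI_ex)
  show ?a
    unfolding largest_eigenvalue_def spectrum_adjacency_matrix[OF e] nbrs_def ..
  let ?vs = "SOME vs. vertex_enum G vs"
  have "finite (spectrum (adjacency_matrix G ?vs))"
    by (rule card_finite_spectrum(1)[of _ "length ?vs"]) (simp add: adjacency_matrix_def)
  then show ?b unfolding spectrum_adjacency_matrix[OF e] nbrs_def .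
qed

lemma eigenvalue_le_largest:
  assumes "pair_graph G" "u \<in> pverts G" "x u \<noteq> 0"
    "\<And>u. u \<in> pverts G \<Longrightarrow> (\<Sum>v \<in> nbrs (pverts G) (parcs G) u. x v) = l * x u"
  shows "l \<le> largest_eigenvalue G"
  unfolding largest_eigenvalue_alt(1)[OF assms(1)]
  by (rule Max_ge[OF largest_eigenvalue_alt(2)[OF assms(1)]]) (use assms in blast)

text \<open>The value \<open>l\<close> of the Rayleigh maximiser is an eigenvalue, and any
  eigenvalue is the Rayleigh quotient of its eigenvector, hence at most \<open>l\<close>. Dividing
  by the largest entry gives the normalisation.\<close>

lemma perron_vector:
  assumes G: "pair_graph G" and ne: "pverts G \<noteq> {}"
  obtains x u where "u \<in> pverts G" "x u = 1"
    "\<And>v. v \<in> pverts G \<Longrightarrow> 0 \<le> x v \<and> x v \<le> (1::real)"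
    "\<And>v. v \<in> pverts G \<Longrightarrow> (\<Sum>y \<in> nbrs (pverts G) (parcs G) v. x y) = largest_eigenvalue G * x v"
proof -
  let ?V = "pverts G" and ?E = "parcs G"
  note g = pair_graph_facts[OF G]
  obtain x :: "'a \<Rightarrow> real" and l where x: "\<And>v. x v \<ge> 0" "\<exists>v\<in>?V. x v > 0"
    "\<And>v. v \<in> ?V \<Longrightarrow> (\<Sum>y\<in>nbrs ?V ?E v. x y) = l * x v"
    "\<And>z :: 'a \<Rightarrow> real. (\<Sum>v\<in>?V. \<Sum>y\<in>nbrs ?V ?E v. z v * z y) \<le> l * (\<Sum>v\<in>?V. (z v)\<^sup>2)"
    by (rule rayleigh_maximizer[OF g(1) ne g(2,3)]) (blast intro: that)
  have "l = largest_eigenvalue G"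
    unfolding largest_eigenvalue_alt(1)[OF G]
  proof (rule Max_eqI[symmetric])
    fix k :: real assume "k \<in> {l. \<exists>x. (\<exists>u\<in>?V. x u \<noteq> 0) \<and> (\<forall>u\<in>?V. (\<Sum>v\<in>nbrs ?V ?E u. x v) = l * x u)}"
    then obtain z :: "'a \<Rightarrow> real" and u where z: "u \<in> ?V" "z u \<noteq> 0"
      "\<And>u. u \<in> ?V \<Longrightarrow> (\<Sum>v\<in>nbrs ?V ?E u. z v) = k * z u" by blast
    have "k * (\<Sum>v\<in>?V. (z v)\<^sup>2) = (\<Sum>v\<in>?V. \<Sum>y\<in>nbrs ?V ?E v. z v * z y)"
      unfolding sum_distrib_left
    proof (rule sum.cong[OF refl])
      fix v assume "v \<in> ?V"
      then show "k * (z v)\<^sup>2 = (\<Sum>y\<in>nbrs ?V ?E v. z v * z y)"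
        using z(3) by (simp add: power2_eq_square flip: sum_distrib_left)
    qed
    also have "\<dots> \<le> l * (\<Sum>v\<in>?V. (z v)\<^sup>2)" by (rule x(4))
    finally have "k * (\<Sum>v\<in>?V. (z v)\<^sup>2) \<le> l * (\<Sum>v\<in>?V. (z v)\<^sup>2)" .
    moreover have "(\<Sum>v\<in>?V. (z v)\<^sup>2) > 0" using z(1,2) g(1) by (intro sum_pos2[of _ u]) auto
    ultimately show "k \<le> l" by simp
  qed (use x largest_eigenvalue_alt(2)[OF G] in \<open>auto simp: less_le intro!: exI[of _ x]\<close>)
  define M where "M = Max (x ` ?V)"
  have "M \<in> x ` ?V" unfolding M_def using g(1) ne by (intro Max_in) auto
  then obtain u where u: "u \<in> ?V" "x u = M" by auto
  have le: "x v \<le> M" if "v \<in> ?V" for v unfolding M_def using g(1) that by simp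
  have M: "M > 0" using x(2) le by force
  show thesis
  proof (rule that[of u "\<lambda>v. x v / M"])
    fix v assume "v \<in> ?V"
    then show "(\<Sum>y\<in>nbrs ?V ?E v. x y / M) = largest_eigenvalue G * (x v / M)"
      using x(3) \<open>l = _\<close> by (simp add: sum_divide_distrib[symmetric])
  qed (use u M x(1) le in auto)
qed

subsection \<open>The neighbourhood of a vertex of maximal weight\<close>

text \<open>
  \<open>S\<^sup>t\<^bsub>n,2\<^esub>\<close> up to naming of the vertices: \<open>u\<close> and \<open>c\<close> are the two dominating vertices of the
  complete split graph, \<open>L\<close> are its other vertices, and \<open>I\<close> are the \<open>t\<close> pendant vertices at \<open>u\<close>.
\<close>

definition pendant_form :: "'a set \<Rightarrow> ('a \<times> 'a) set \<Rightarrow> 'a \<Rightarrow> 'a \<Rightarrow> 'a set \<Rightarrow> 'a set \<Rightarrow> bool" where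
  "pendant_form V E u c L I \<longleftrightarrow> finite L \<and> finite I \<and> u \<noteq> c \<and> u \<notin> L \<union> I \<and> c \<notin> L \<union> I \<and> L \<inter> I = {} \<and>
     V = insert u (insert c (L \<union> I)) \<and>
     E = {(u, c), (c, u)} \<union> {u} \<times> (L \<union> I) \<union> (L \<union> I) \<times> {u} \<union> {c} \<times> L \<union> L \<times> {c}"

text \<open>The two numerical assumptions are what \<open>rho1_bounds\<close> extracts from
  \<open>\<lambda>(G) \<ge> \<rho>\<^sub>1(m)\<close> for all \<open>m\<close>; the sharper bound
  for even \<open>m\<close> enters as a premise of \<open>B_empty\<close> and
  \<open>pendant_structure\<close>. Connectedness is not assumed, so \<open>x\<close> may vanish at
  some vertices.\<close>

locale c5_free_perron =
  fixes V :: "'a set" and E :: "('a \<times> 'a) set" and x :: "'a \<Rightarrow> real" and l :: real and u :: 'a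
    and m :: nat
  assumes fin: "finite V" and sym: "sym E" and irr: "(v, v) \<notin> E"
    and sub: "(v, w) \<in> E \<Longrightarrow> v \<in> V \<and> w \<in> V"
    and nonisolated: "v \<in> V \<Longrightarrow> nbrs V E v \<noteq> {}"
    and c5_free: "\<lbrakk>(a, b) \<in> E; (b, c) \<in> E; (c, d) \<in> E; (d, e) \<in> E; (e, a) \<in> E\<rbrakk>
      \<Longrightarrow> \<not> distinct [a, b, c, d, e]"
    and card_E: "card E = 2 * m"
    and u: "u \<in> V" "x u = 1" and x_nonneg: "v \<in> V \<Longrightarrow> 0 \<le> x v" and x_le: "v \<in> V \<Longrightarrow> x v \<le> 1"
    and eigen: "v \<in> V \<Longrightarrow> (\<Sum>y\<in>nbrs V E v. x y) = l * x v"
    and l_gt: "l > 5" and slack: "real m - l\<^sup>2 + l < 2"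
begin

definition A where "A = nbrs V E u"
definition B where "B = V - insert u A"

abbreviation NA where "NA \<equiv> nbrs A E"
abbreviation NB where "NB \<equiv> nbrs B E"

definition dA where "dA v = real (card (NA v))"
definition dB where "dB v = real (card (NB v))"

lemma E_sym: "(v, w) \<in> E \<longleftrightarrow> (w, v) \<in> E"
  using sym by (auto dest: symD)

lemma E_symD: "(v, w) \<in> E \<Longrightarrow> (w, v) \<in> E"
  using sym by (auto dest: symD)

lemma finA [simp]: "finite A" and finB [simp]: "finite B"
  using fin by (auto simp: A_def B_def)

lemma A_iff: "v \<in> A \<longleftrightarrow> (u, v) \<in> E"
  using sub by (auto simp: A_def)

lemma A_V: "v \<in> A \<Longrightarrow> v \<in> V" and B_V: "v \<in> B \<Longrightarrow> v \<in> V"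
  by (auto simp: A_def B_def)

lemma u_notin: "u \<notin> A" "u \<notin> B"
  using irr by (auto simp: A_iff B_def)

lemma sum_V:
  fixes f :: "'a \<Rightarrow> real"
  shows "sum f V = f u + sum f A + sum f B"
proof -
  have "V = insert u (A \<union> B)" using u A_V by (auto simp: B_def)
  moreover have "A \<inter> B = {}" by (auto simp: B_def)
  then have "sum f (insert u (A \<union> B)) = f u + sum f A + sum f B"
    using u_notin by (simp add: sum.union_disjoint)
  ultimately show ?thesis by metis
qed

lemma sum_nbrs_V:
  fixes f :: "'a \<Rightarrow> real"
  shows "sum f (nbrs V E v) = (if (v, u) \<in> E then f u else 0) + sum f (NA v) + sum f (NB v)"
  by (simp only: sum_nbrs[OF fin] sum_nbrs[OF finA] sum_nbrs[OF finB] sum_V)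

lemma NA_sym: "v \<in> A \<Longrightarrow> z \<in> NA v \<Longrightarrow> v \<in> NA z"
  using E_symD by auto

lemma dA_sum: "dA v = (\<Sum>y\<in>NA v. 1)" and dB_sum: "dB v = (\<Sum>y\<in>NB v. 1)"
  by (simp_all add: dA_def dB_def)

lemma dA_nonneg [simp]: "dA v \<ge> 0" and dB_nonneg [simp]: "dB v \<ge> 0"
  by (simp_all add: dA_def dB_def)

lemma eigen_A: "v \<in> A \<Longrightarrow> l * x v = 1 + sum x (NA v) + sum x (NB v)"
  using eigen[of v, OF A_V] sum_nbrs_V[of x v] u E_sym A_iff by auto

lemma eigen_B: "v \<in> B \<Longrightarrow> l * x v = sum x (NA v) + sum x (NB v)"
proof -
  assume v: "v \<in> B"
  then have "(v, u) \<notin> E" using E_sym A_iff by (auto simp: B_def)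
  then show ?thesis using eigen[of v, OF B_V[OF v]] sum_nbrs_V[of x v] by simp
qed

lemma eigen_u: "l = sum x A"
  using eigen[OF u(1)] u(2) by (simp add: A_def)

lemma sum_x_le: "S \<subseteq> V \<Longrightarrow> sum x S \<le> card S"
  using sum_bounded_above[of S x 1] x_le by (auto simp: subset_iff)

lemma sum_x_nonneg: "S \<subseteq> V \<Longrightarrow> sum x S \<ge> 0"
  using x_nonneg by (auto intro!: sum_nonneg)

lemma NA_V: "NA v \<subseteq> V" and NB_V: "NB v \<subseteq> V"
  using A_V B_V by auto

section \<open>The edge count, the square of \<open>l\<close>, and the total
  \<open>m - l^2 + l\<close>\<close>

lemma edge_count:
  "2 * real m = 2 * real (card A) + (\<Sum>v\<in>A. dA v) + 2 * (\<Sum>w\<in>B. dA w) + (\<Sum>w\<in>B. dB w)"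
proof -
  have "E = Sigma V (nbrs V E)" using sub by auto
  moreover have "card (Sigma V (nbrs V E)) = (\<Sum>v\<in>V. card (nbrs V E v))"
    using fin by (intro card_SigmaI) auto
  ultimately have "card E = (\<Sum>v\<in>V. card (nbrs V E v))" by (rule ssubst)
  then have "real (2 * m) = real (\<Sum>v\<in>V. card (nbrs V E v))" using card_E by simp
  then have "2 * real m = (\<Sum>v\<in>V. real (card (nbrs V E v)))" by simp
  also have "\<dots> = (\<Sum>v\<in>V. \<Sum>y\<in>nbrs V E v. 1)" by simp
  also have "\<dots> = (\<Sum>v\<in>V. (if (v, u) \<in> E then 1 else 0) + dA v + dB v)"
    unfolding sum_nbrs_V dA_sum dB_sum ..
  also have "\<dots> = dA u + dB u + (\<Sum>v\<in>A. 1 + dA v + dB v) + (\<Sum>w\<in>B. dA w + dB w)"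
  proof -
    have "(\<Sum>v\<in>A. (if (v, u) \<in> E then 1 else 0) + dA v + dB v) = (\<Sum>v\<in>A. 1 + dA v + dB v)"
      using E_sym A_iff by (intro sum.cong) auto
    moreover have "(\<Sum>v\<in>B. (if (v, u) \<in> E then 1 else 0) + dA v + dB v) = (\<Sum>v\<in>B. dA v + dB v)"
      using E_sym A_iff by (intro sum.cong) (auto simp: B_def)
    ultimately show ?thesis using irr by (simp add: sum_V)
  qed
  \<comment> \<open>\<open>u\<close> has no neighbour in \<open>B\<close>, and the edges between
    \<open>A\<close> and \<open>B\<close> counted from the \<open>A\<close> side are recounted from
    the \<open>B\<close> side.\<close>
  also have "\<dots> = card A + (card A + (\<Sum>v\<in>A. dA v) + (\<Sum>w\<in>B. dA w))
      + ((\<Sum>w\<in>B. dA w) + (\<Sum>w\<in>B. dB w))"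
  proof -
    have "NA u = A" "NB u = {}" by (auto simp: A_iff B_def)
    then have "dA u = card A" "dB u = 0" by (simp_all add: dA_def dB_def)
    moreover have "(\<Sum>v\<in>A. dB v) = (\<Sum>w\<in>B. dA w)"
      unfolding dA_sum dB_sum by (rule sum_nbrs_swap) (use sym in auto)
    ultimately show ?thesis by (simp add: sum.distrib)
  qed
  finally show ?thesis by simp
qed

text \<open>Walks of length two from \<open>u\<close>, weighted by \<open>x\<close> at their end:
  those returning to \<open>u\<close> give \<open>card A\<close>, those ending at another vertex
  \<open>y\<close> number \<open>dA y\<close>.\<close>

lemma l_square: "l\<^sup>2 = card A + (\<Sum>v\<in>A. dA v * x v) + (\<Sum>w\<in>B. dA w * x w)"
proof -
  have "l\<^sup>2 = (\<Sum>v\<in>A. l * x v)"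
    using eigen_u by (simp add: power2_eq_square sum_distrib_left[symmetric])
  also have "\<dots> = (\<Sum>v\<in>A. 1 + sum x (NA v) + sum x (NB v))"
    using eigen_A by (intro sum.cong) auto
  also have "\<dots> = card A + (\<Sum>v\<in>A. sum x (NA v)) + (\<Sum>v\<in>A. sum x (NB v))"
    by (simp add: sum.distrib)
  also have "(\<Sum>v\<in>A. sum x (NA v)) = (\<Sum>y\<in>A. \<Sum>v\<in>NA y. x y)"
    by (rule sum_nbrs_swap) (use sym in auto)
  also have "(\<Sum>v\<in>A. sum x (NB v)) = (\<Sum>y\<in>B. \<Sum>v\<in>NA y. x y)"
    by (rule sum_nbrs_swap) (use sym in auto)
  finally show ?thesis by (simp add: dA_def)
qed

text \<open>
  A vertex \<open>v\<close> of \<open>A\<close> contributes \<open>dA v / 2 - (dA v - 1) * x v\<close> to the total, which is negative at the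
  centre of a big star. The term \<open>h\<close> discharges the share \<open>1/2\<close> of each leaf to its centre, which
  makes all contributions nonnegative.
\<close>

definition h where "h v = (if dA v = 1 then 1/2 else 0 :: real)"
definition wt where "wt v = dA v / 2 - (dA v - 1) * x v + (\<Sum>y\<in>NA v. h y) - h v"

text \<open>\<open>edge_count\<close> minus \<open>l_square\<close>, plus \<open>l\<close> as the
  sum of \<open>x\<close> over \<open>A\<close>. The discharging by \<open>h\<close> cancels in the
  sum over \<open>A\<close>.\<close>

lemma slack_eq: "real m - l\<^sup>2 + l = sum wt A + (\<Sum>w\<in>B. dB w) / 2 + (\<Sum>w\<in>B. dA w * (1 - x w))"
proof -
  have "(\<Sum>v\<in>A. \<Sum>y\<in>NA v. h y) = (\<Sum>y\<in>A. \<Sum>v\<in>NA y. h y)"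
    by (rule sum_nbrs_swap) (use sym in auto)
  \<comment> \<open>Each \<open>y\<close> is counted \<open>dA y\<close> times, and
    \<open>h y\<close> is nonzero only if \<open>dA y = 1\<close>.\<close>
  also have "\<dots> = (\<Sum>y\<in>A. h y)"
    by (intro sum.cong refl) (simp add: h_def dA_def)
  finally have "sum wt A = (\<Sum>v\<in>A. dA v / 2 - (dA v - 1) * x v)"
    unfolding wt_def sum.distrib sum_subtractf by simp
  also have "\<dots> = (\<Sum>v\<in>A. dA v) / 2 - (\<Sum>v\<in>A. dA v * x v) + l"
    using eigen_u by (simp add: sum.distrib sum_subtractf left_diff_distrib sum_divide_distrib)
  finally have *: "sum wt A = (\<Sum>v\<in>A. dA v) / 2 - (\<Sum>v\<in>A. dA v * x v) + l" .
  have "(\<Sum>w\<in>B. dA w * (1 - x w)) = (\<Sum>w\<in>B. dA w) - (\<Sum>w\<in>B. dA w * x w)"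
    by (simp add: right_diff_distrib sum_subtractf)
  then show ?thesis using * l_square edge_count by simp
qed

section \<open>Components of \<open>G[A]\<close> and nonnegativity of their weights\<close>

lemma P4_free:
  assumes "(a, b) \<in> E" "(b, c) \<in> E" "(c, d) \<in> E" "a \<in> A" "b \<in> A" "c \<in> A" "d \<in> A"
  shows "\<not> distinct [a, b, c, d]"
proof -
  \<comment> \<open>The common neighbour \<open>u\<close> of \<open>a\<close> and \<open>d\<close>
    closes the path to a five-cycle.\<close>
  have "(u, a) \<in> E" "(d, u) \<in> E" "u \<notin> set [a, b, c, d]"
    using assms u_notin by (auto simp: A_iff intro: E_symD)
  then show ?thesis using c5_free[of u a b c d] assms by simp
qed

lemma dA_ge_2_other:
  assumes "dA v \<ge> 2"
  obtains y where "y \<in> NA v" "y \<noteq> w"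
proof -
  have "card (NA v) \<ge> 2" using assms by (simp add: dA_def)
  then have "\<not> NA v \<subseteq> {w}" using card_mono[of "{w}" "NA v"] by auto
  then show thesis using that by blast
qed

lemma dA_pos: "y \<in> NA v \<Longrightarrow> dA v \<ge> 1"
  unfolding dA_def using card_gt_0_iff[of "NA v"] finite_nbrs[OF finA] by fastforce

lemma dA_zero: "dA v < 1 \<Longrightarrow> NA v = {}"
  using dA_pos by force

lemma dA_cases: obtains "dA v = 0" | "dA v = 1" | "dA v \<ge> 2"
  unfolding dA_def by (cases "card (NA v)"; cases "card (NA v) - 1") auto

lemma dA_one: "dA v = 1 \<Longrightarrow> y \<in> NA v \<Longrightarrow> NA v = {y}"
  unfolding dA_def by (auto simp: card_1_singleton_iff simp del: in_nbrs)

text \<open>A neighbour of \<open>y\<close> other than \<open>z\<close> and a neighbour of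
  \<open>z\<close> other than \<open>y\<close> must coincide, since otherwise they form a path on
  four vertices with \<open>y\<close> and \<open>z\<close>. This gives a unique common neighbour
  \<open>t\<close>, and a further neighbour \<open>q\<close> of \<open>t\<close> would give the path
  \<open>q t y z\<close>.\<close>

lemma triangle_component:
  assumes "y \<in> A" "z \<in> NA y" "dA y \<ge> 2" "dA z \<ge> 2"
  obtains t where "distinct [y, z, t]" "NA y = {z, t}" "NA z = {y, t}" "NA t = {y, z}"
proof -
  have z: "z \<in> A" "(y, z) \<in> E" "(z, y) \<in> E" "y \<noteq> z" using assms E_symD irr by auto
  obtain t where t: "t \<in> NA y" "t \<noteq> z" using dA_ge_2_other[OF assms(3)] .
  obtain s where s: "s \<in> NA z" "s \<noteq> y" using dA_ge_2_other[OF assms(4)] .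
  have eq: "t' = s'" if a: "t' \<in> NA y" "t' \<noteq> z" "s' \<in> NA z" "s' \<noteq> y" for t' s'
  proof (rule ccontr)
    assume "t' \<noteq> s'"
    moreover have "(t', y) \<in> E" "t' \<noteq> y" "s' \<noteq> z" using a E_symD irr by auto
    ultimately show False using P4_free[of t' y z s'] a z assms(1) by simp
  qed
  have tA: "t \<in> A" "(y, t) \<in> E" "(z, t) \<in> E" "(t, y) \<in> E" "(t, z) \<in> E" "t \<noteq> y"
    using t s eq[OF t s] E_symD irr by auto
  have "NA y = {z, t}"
  proof (intro equalityI subsetI)
    show "q \<in> {z, t}" if "q \<in> NA y" for q
      using eq[OF that _ s] eq[OF t s] by blast
  qed (use z tA in auto)
  moreover have "NA z = {y, t}"
  proof (intro equalityI subsetI)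
    show "q \<in> {y, t}" if "q \<in> NA z" for q
      using eq[OF t that] by blast
  qed (use assms(1) z tA in auto)
  moreover have "NA t = {y, z}"
  proof (intro equalityI subsetI)
    fix q assume q: "q \<in> NA t"
    then have "(q, t) \<in> E" "q \<noteq> t" "q \<in> A" using E_symD irr by auto
    then show "q \<in> {y, z}"
      using P4_free[of q t y z] z tA t assms(1) by auto
  qed (use assms(1) z tA in auto)
  moreover have "distinct [y, z, t]" using t z tA by auto
  ultimately show thesis using that by blast
qed

lemma wt_zero: "dA v = 0 \<Longrightarrow> wt v = x v"
  using dA_zero[of v] by (simp add: wt_def h_def)

lemma wt_triangle:
  assumes "distinct [y, z, t]" "NA y = {z, t}" "NA z = {y, t}" "NA t = {y, z}"
  shows "wt y = 1 - x y"
proof -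
  have "dA y = 2" "dA z = 2" "dA t = 2" using assms by (auto simp: dA_def)
  then show ?thesis using assms by (simp add: wt_def h_def)
qed

text \<open>The halves received from the leaves raise \<open>dA c / 2\<close> to
  \<open>dA c\<close>. The term \<open>h c\<close> survives only if the star is a single edge, where
  \<open>c\<close> is a leaf as well.\<close>

lemma wt_center:
  assumes "\<And>z. z \<in> NA c \<Longrightarrow> dA z = 1"
  shows "wt c = dA c - (dA c - 1) * x c - h c"
proof -
  have "(\<Sum>y\<in>NA c. h y) = (\<Sum>y\<in>NA c. 1/2)" using assms by (intro sum.cong) (auto simp: h_def)
  then show ?thesis by (simp add: wt_def dA_def)
qed

lemma h_nonneg: "h v \<ge> 0" by (simp add: h_def)

text \<open>An isolated vertex of \<open>G[A]\<close> keeps \<open>x v\<close>. A vertex of degree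
  one gives away exactly its \<open>1/2\<close>. A triangle vertex keeps \<open>1 - x v\<close>, and
  the centre of a star with several leaves keeps at least \<open>1\<close>.\<close>

lemma wt_nonneg:
  assumes v: "v \<in> A"
  shows "wt v \<ge> 0"
proof (cases v rule: dA_cases)
  case 1
  then show ?thesis using wt_zero x_nonneg A_V v by auto
next
  case 2
  then show ?thesis using sum_nonneg[of "NA v" h] h_nonneg by (simp add: wt_def h_def[of v])
next
  case 3
  show ?thesis
  proof (cases "\<exists>z\<in>NA v. dA z \<ge> 2")
    case True
    then obtain z where z: "z \<in> NA v" "dA z \<ge> 2" by blast
    obtain t where "distinct [v, z, t]" "NA v = {z, t}" "NA z = {v, t}" "NA t = {v, z}"
      using triangle_component[OF v z(1) 3 z(2)] .
    then have "wt v = 1 - x v" by (rule wt_triangle)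
    then show ?thesis using x_le A_V v by auto
  next
    case False
    have "dA z = 1" if "z \<in> NA v" for z
    proof -
      have "dA z \<ge> 1" using that v E_sym dA_pos[of v z] by auto
      then show ?thesis using False that by (cases z rule: dA_cases) auto
    qed
    then have "wt v = dA v - (dA v - 1) * x v"
      using wt_center[of v] 3 by (simp add: h_def)
    moreover have "(dA v - 1) * x v \<le> (dA v - 1) * 1"
      using 3 x_le[OF A_V[OF v]] by (intro mult_left_mono) auto
    ultimately show ?thesis by simp
  qed
qed

section \<open>Excluding triangles in \<open>G[A]\<close>\<close>

lemma B_terms_nonneg: "0 \<le> (\<Sum>w\<in>B. dB w)" "w \<in> B \<Longrightarrow> 0 \<le> dA w * (1 - x w)"
  using x_le B_V by (auto intro!: sum_nonneg mult_nonneg_nonneg)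

lemma wt_subset: "S \<subseteq> A \<Longrightarrow> sum wt S \<le> sum wt A"
  by (rule sum_mono2) (use wt_nonneg in auto)

text \<open>The edges of \<open>G[B]\<close> at \<open>w\<close> are counted once at
  \<open>w\<close> and once at their other ends.\<close>

lemma dB_bound:
  assumes w: "w \<in> B"
  shows "2 * dB w \<le> (\<Sum>v\<in>B. dB v)"
proof -
  have wn: "w \<notin> NB w" using irr by auto
  have "1 \<le> dB v" if "v \<in> NB w" for v
  proof -
    have "w \<in> NB v" using that w E_sym by auto
    then show ?thesis unfolding dB_def using card_gt_0_iff[of "NB v"] finite_nbrs[OF finB] by fastforce
  qed
  then have "(\<Sum>v\<in>NB w. 1) \<le> (\<Sum>v\<in>NB w. dB v)" by (rule sum_mono)
  then have "2 * dB w \<le> (\<Sum>v\<in>insert w (NB w). dB v)"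
    using wn by (simp add: dB_sum)
  also have "\<dots> \<le> (\<Sum>v\<in>B. dB v)" by (rule sum_mono2) (use w in auto)
  finally show ?thesis .
qed

lemma dB_le_1:
  assumes w: "w \<in> B"
  shows "dB w \<le> 1"
proof -
  have "(\<Sum>w\<in>B. dA w * (1 - x w)) \<ge> 0" by (rule sum_nonneg) (rule B_terms_nonneg)
  moreover have "sum wt A \<ge> 0" by (rule sum_nonneg) (rule wt_nonneg)
  ultimately have "dB w < 2" using slack slack_eq dB_bound[OF w] by simp
  then show ?thesis unfolding dB_def by simp
qed

text \<open>Let \<open>s\<close> be the sum of \<open>x\<close> over the triangle, \<open>k\<close>
  the number of edges from it to \<open>B\<close>, and \<open>y\<close> the sum of \<open>x\<close>
  over the \<open>B\<close>-ends of these edges. The triangle and these edges contribute at least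
  \<open>3 - s + k - y\<close>. Adding the three eigenvalue equations gives
  \<open>3 * s \<le> 3 + y\<close>, and a vertex of \<open>B\<close> adjacent to the triangle has
  entry at most \<open>2/5\<close>, so \<open>y \<le> 2/5 * k\<close>. The contribution is thus at
  least \<open>2\<close>.\<close>

lemma no_triangle:
  assumes d: "distinct [a, b, c]" and N: "NA a = {b, c}" "NA b = {a, c}" "NA c = {a, b}"
  shows False
proof -
  define T where "T = {a, b, c}"
  have "b \<in> NA a" "c \<in> NA a" "a \<in> NA b" "c \<in> NA b" "a \<in> NA c" "b \<in> NA c"
    unfolding N by simp_all
  then have TA: "T \<subseteq> A" and arcs: "(a, b) \<in> E" "(b, a) \<in> E" "(a, c) \<in> E" "(c, a) \<in> E" "(b, c) \<in> E" "(c, b) \<in> E"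
    by (simp_all add: T_def)
  have finT: "finite T" by (simp add: T_def)
  define dT where "dT w = real (card (nbrs T E w))" for w
  have dTA: "dT w \<le> dA w" for w
    unfolding dT_def dA_def using TA by (auto intro!: card_mono)
  have xw: "x w \<le> 2 / 5" if w: "w \<in> B" "dT w \<noteq> 0" for w
  proof -
    have "nbrs T E w \<noteq> {}" using w unfolding dT_def by auto
    then obtain p where p: "p \<in> T" "(w, p) \<in> E" by auto
    \<comment> \<open>A second neighbour \<open>q\<close> of \<open>w\<close> in \<open>A\<close>
      would close the five-cycle \<open>u r p w q\<close>, where \<open>r\<close> is a triangle
      vertex different from \<open>p\<close> and \<open>q\<close>.\<close>
    have "q = p" if q: "q \<in> NA w" for q
    proof (rule ccontr)
      assume "q \<noteq> p"
      have "p = a \<or> p = b \<or> p = c" using p(1) by (simp add: T_def)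
      then have "\<exists>r. r \<in> T \<and> r \<noteq> p \<and> r \<noteq> q \<and> (r, p) \<in> E"
        using d arcs unfolding T_def by (elim disjE) (metis distinct_length_2_or_more insertI1 insertI2)+
      then obtain r where r: "r \<in> T" "r \<noteq> p" "r \<noteq> q" "(r, p) \<in> E" by blast
      have "\<not> distinct [u, r, p, w, q]"
      proof (rule c5_free)
        show "(u, r) \<in> E" using r TA A_iff by blast
        show "(r, p) \<in> E" by (rule r)
        show "(p, w) \<in> E" by (rule E_symD[OF p(2)])
        show "(w, q) \<in> E" "(q, u) \<in> E" using q A_iff E_symD by auto
      qed
      moreover have "p \<in> A" "r \<in> A" "q \<in> A" "w \<notin> A" "w \<noteq> u" using p q r w TA by (auto simp: B_def)
      ultimately show False
        using r \<open>q \<noteq> p\<close> u_notin(1) by auto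
    qed
    then have "NA w \<subseteq> {p}" by auto
    then have "dA w \<le> 1" unfolding dA_def using card_mono[of "{p}" "NA w"] by simp
    have "l * x w \<le> dA w + dB w"
      using eigen_B[OF w(1)] sum_x_le[OF NA_V, of w] sum_x_le[OF NB_V, of w] by (simp add: dA_def dB_def)
    then have "l * x w \<le> 2" using \<open>dA w \<le> 1\<close> dB_le_1[OF w(1)] by simp
    moreover have "5 * x w \<le> l * x w"
      using l_gt x_nonneg[OF B_V[OF w(1)]] by (intro mult_right_mono) auto
    ultimately show ?thesis by simp
  qed
  define s where "s = x a + x b + x c"
  define k where "k = (\<Sum>w\<in>B. dT w)"
  define y where "y = (\<Sum>w\<in>B. dT w * x w)"
  have y0: "y \<ge> 0" unfolding y_def using x_nonneg B_V by (auto intro!: sum_nonneg simp: dT_def)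
  have "y \<le> (\<Sum>w\<in>B. dT w * (2/5))"
    unfolding y_def
  proof (rule sum_mono)
    fix w assume "w \<in> B"
    then show "dT w * x w \<le> dT w * (2/5)"
      using xw[of w] by (cases "dT w = 0") (auto simp: dT_def intro!: mult_left_mono)
  qed
  then have yk: "y \<le> 2/5 * k" by (simp only: k_def sum_distrib_right mult.commute)
  have "(\<Sum>v\<in>T. sum x (NB v)) = (\<Sum>w\<in>B. \<Sum>v\<in>nbrs T E w. x w)"
    by (rule sum_nbrs_swap) (use sym finT in auto)
  then have "(\<Sum>v\<in>T. sum x (NB v)) = y" by (simp add: y_def dT_def)
  moreover have "(\<Sum>v\<in>T. sum x (NB v)) = sum x (NB a) + sum x (NB b) + sum x (NB c)"
    using d by (simp add: T_def)
  moreover have "l * x a = 1 + (x b + x c) + sum x (NB a)" "l * x b = 1 + (x a + x c) + sum x (NB b)"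
    "l * x c = 1 + (x a + x b) + sum x (NB c)"
    using eigen_A[of a] eigen_A[of b] eigen_A[of c] TA d by (simp_all add: T_def N)
  ultimately have "l * s = 3 + 2 * s + y" by (simp add: s_def algebra_simps)
  moreover have "s \<ge> 0" using x_nonneg A_V TA by (simp add: s_def T_def)
  then have "5 * s \<le> l * s" using l_gt by (intro mult_right_mono) auto
  ultimately have s: "3 * s \<le> 3 + y" by simp
  have "wt a = 1 - x a" "wt b = 1 - x b" "wt c = 1 - x c"
    using wt_triangle[of a b c] wt_triangle[of b a c] wt_triangle[of c a b] d N
    by (auto simp: insert_commute)
  then have "sum wt T = 3 - s" using d by (simp add: T_def s_def)
  then have "3 - s \<le> sum wt A" using wt_subset[OF TA] by simp
  moreover have "k - y \<le> (\<Sum>w\<in>B. dA w * (1 - x w))"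
    unfolding k_def y_def sum_subtractf[symmetric]
  proof (rule sum_mono)
    fix w assume "w \<in> B"
    then have "dT w * (1 - x w) \<le> dA w * (1 - x w)"
      using dTA x_le B_V by (intro mult_right_mono) auto
    then show "dT w - dT w * x w \<le> dA w * (1 - x w)" by (simp add: right_diff_distrib)
  qed
  ultimately have "3 - s + (k - y) < 2" using slack slack_eq B_terms_nonneg(1) by linarith
  then show False using s yk y0 by linarith
qed

text \<open>Two adjacent vertices of degree at least two would span a triangle component.\<close>

lemma leaf_of_branch:
  assumes "y \<in> A" "z \<in> NA y" "dA y \<ge> 2"
  shows "dA z = 1"
proof (rule ccontr)
  assume "dA z \<noteq> 1"
  moreover have "dA z \<ge> 1" by (rule dA_pos[OF NA_sym[OF assms(1,2)]])
  ultimately have "dA z \<ge> 2" by (cases z rule: dA_cases) auto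
  then obtain t where "distinct [y, z, t]" "NA y = {z, t}" "NA z = {y, t}" "NA t = {y, z}"
    by (rule triangle_component[OF assms])
  then show False by (rule no_triangle)
qed

text \<open>The centre of a star component of \<open>G[A]\<close> with at least one edge; both ends
  of a single-edge component qualify.\<close>

definition center where
  "center c \<longleftrightarrow> c \<in> A \<and> dA c \<ge> 1 \<and> (\<forall>z\<in>NA c. dA z = 1)"

abbreviation star where "star c \<equiv> insert c (NA c)"

lemma center_exists:
  assumes "y \<in> A" "dA y \<ge> 1"
  obtains c where "center c" "y \<in> star c"
proof (cases y rule: dA_cases)
  case 2
  have "NA y \<noteq> {}" using assms(2) by (auto simp: dA_def)
  then obtain z where z: "z \<in> NA y" by blast
  have y: "y \<in> NA z" by (rule NA_sym[OF assms(1) z])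
  show thesis
  proof (cases z rule: dA_cases)
    case 1
    then show thesis using dA_pos[OF y] by simp
  next
    case d1: 2
    have "NA y = {z}" using dA_one[OF 2 z] .
    then show thesis using that[of y] assms d1 by (simp add: center_def)
  next
    case 3
    then have "center z" using leaf_of_branch[of z] z by (simp add: center_def)
    then show thesis using that[of z] y by blast
  qed
next
  case 3
  then have "center y" using leaf_of_branch[of y] assms by (simp add: center_def)
  then show thesis using that by blast
qed (use assms in auto)

lemma star_leaf: "center c \<Longrightarrow> z \<in> NA c \<Longrightarrow> NA z = {c}"
  using dA_one[of z c] NA_sym[of c z] by (simp add: center_def del: in_nbrs)

text \<open>A leaf loses its own \<open>1/2\<close> and receives \<open>h c\<close>, so its weight
  is \<open>h c\<close>.\<close>

lemma star_weight:
  assumes c: "center c"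
  shows "sum wt (star c) = dA c - (dA c - 1) * x c"
proof -
  have "wt z = h c" if z: "z \<in> NA c" for z
  proof -
    have "dA z = 1" using c z by (simp add: center_def del: in_nbrs)
    moreover have "(\<Sum>y\<in>NA z. h y) = h c" by (simp only: star_leaf[OF c z]) simp
    ultimately show ?thesis by (simp add: wt_def h_def[of z])
  qed
  then have "sum wt (NA c) = dA c * h c" by (simp add: dA_def)
  \<comment> \<open>\<open>h c\<close> is nonzero only when \<open>dA c = 1\<close>, so the leaf
    weights cancel the \<open>- h c\<close> of the centre.\<close>
  moreover have "dA c * h c = h c" by (simp add: h_def)
  moreover have "wt c = dA c - (dA c - 1) * x c - h c"
    by (rule wt_center) (use c in \<open>simp add: center_def\<close>)
  moreover have "sum wt (star c) = wt c + sum wt (NA c)"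
    using irr by (intro sum.insert) auto
  ultimately show ?thesis by simp
qed

lemma star_weight_ge_1:
  assumes c: "center c"
  shows "sum wt (star c) \<ge> 1"
proof -
  have "c \<in> A" "dA c \<ge> 1" using c by (simp_all add: center_def)
  then have "(dA c - 1) * x c \<le> (dA c - 1) * 1"
    using x_le[OF A_V] by (intro mult_left_mono) simp_all
  then show ?thesis using star_weight[OF c] by simp
qed

lemma slack_A: "sum wt A < 2"
proof -
  have "(\<Sum>w\<in>B. dA w * (1 - x w)) \<ge> 0" by (rule sum_nonneg) (rule B_terms_nonneg)
  then show ?thesis using slack slack_eq B_terms_nonneg(1) by linarith
qed

lemma star_subset: "center c \<Longrightarrow> star c \<subseteq> A"
  by (auto simp: center_def)

text \<open>A vertex of positive degree outside the star lies in a second star disjoint from it;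
  each costs at least \<open>1\<close>, but the total is below \<open>2\<close>.\<close>

lemma star_unique:
  assumes c: "center c" and v: "v \<in> A" "v \<notin> star c"
  shows "dA v = 0"
proof (rule ccontr)
  assume "dA v \<noteq> 0"
  then have "dA v \<ge> 1" by (cases v rule: dA_cases) simp_all
  then obtain c' where c': "center c'" "v \<in> star c'" using center_exists v(1) by metis
  have n: "c' \<notin> star c"
  proof
    assume "c' \<in> star c"
    then have "c' = c \<or> NA c' = {c}" using star_leaf[OF c] by blast
    then have "star c' \<subseteq> star c" using \<open>c' \<in> star c\<close> by (elim disjE) simp_all
    then show False using c' v by blast
  qed
  have "star c \<inter> star c' = {}"
  proof (rule ccontr)
    assume "star c \<inter> star c' \<noteq> {}"
    then obtain w where w: "w \<in> star c" "w \<in> star c'" by blast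
    then have w': "w \<in> NA c'" using n by blast
    have N: "NA w = {c'}" by (rule star_leaf[OF c'(1) w'])
    from w(1) show False
    proof
      assume "w = c"
      then show False using N n by simp
    next
      assume "w \<in> NA c"
      from star_leaf[OF c this] show False using N n by simp
    qed
  qed
  then have "sum wt (star c \<union> star c') = sum wt (star c) + sum wt (star c')"
    by (intro sum.union_disjoint) simp_all
  moreover have "sum wt (star c \<union> star c') \<le> sum wt A"
    by (intro wt_subset Un_least star_subset c c')
  ultimately show False
    using slack_A star_weight_ge_1[OF c] star_weight_ge_1[OF c'(1)] by linarith
qed

text \<open>Without edges in \<open>A\<close> every weight is \<open>x v\<close>, so the total over
  \<open>A\<close> is \<open>l > 5\<close>.\<close>

lemma exists_center: "\<exists>c. center c"
proof (rule ccontr)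
  assume n: "\<nexists>c. center c"
  have "dA v = 0" if "v \<in> A" for v
  proof -
    have "\<not> dA v \<ge> 1" using n center_exists[OF that] by blast
    then show ?thesis by (cases v rule: dA_cases) simp_all
  qed
  then have "sum wt A = l" unfolding eigen_u by (intro sum.cong) (simp_all add: wt_zero)
  then show False using slack_A l_gt by linarith
qed

subsection \<open>A single star and no further vertices\<close>

text \<open>The star uses up at least \<open>1\<close>, and all other vertices of \<open>A\<close>
  are isolated in \<open>G[A]\<close>. This leaves less than \<open>1\<close> for them, for the
  edges inside \<open>B\<close> and for those between \<open>A\<close> and \<open>B\<close>.\<close>

lemma outside_excess:
  assumes c: "center c"
  shows "1 + sum x (A - star c) + (\<Sum>w\<in>B. dB w) / 2 + (\<Sum>w\<in>B. dA w * (1 - x w)) \<le> real m - l\<^sup>2 + l"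
proof -
  have "sum wt A = sum wt (star c) + sum wt (A - star c)"
    using sum.subset_diff[OF star_subset[OF c] finA, of wt] by simp
  moreover have "sum wt (A - star c) = sum x (A - star c)"
    using star_unique[OF c] by (intro sum.cong refl wt_zero) simp
  ultimately show ?thesis using slack_eq star_weight_ge_1[OF c] by linarith
qed

text \<open>One edge inside \<open>B\<close> costs \<open>1\<close>, which together with the star
  exhausts the bound \<open>2\<close>.\<close>

lemma B_independent:
  assumes "w \<in> B"
  shows "NB w = {}"
proof (rule ccontr)
  assume "NB w \<noteq> {}"
  then have "dB w \<ge> 1" unfolding dB_def using card_gt_0_iff[of "NB w"] by simp
  then have "(\<Sum>w\<in>B. dB w) \<ge> 2" using dB_bound[OF assms] by linarith
  moreover obtain c where "center c" using exists_center by blast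
  moreover have "sum x (A - star c) \<ge> 0" using A_V by (intro sum_x_nonneg) auto
  moreover have "(\<Sum>w\<in>B. dA w * (1 - x w)) \<ge> 0" by (rule sum_nonneg) (rule B_terms_nonneg)
  ultimately show False using outside_excess[of c] slack by fastforce
qed

lemma outside_excess_lt_1:
  assumes c: "center c"
  shows "sum x (A - star c) + (\<Sum>w\<in>B. dA w * (1 - x w)) < 1"
  using outside_excess[OF c] B_terms_nonneg(1) slack by linarith

lemma B_eigen: "w \<in> B \<Longrightarrow> l * x w = sum x (NA w)"
  using eigen_B[of w] B_independent[of w] by simp

text \<open>As \<open>w\<close> is not isolated and has neighbours only in \<open>A\<close>,
  \<open>dA w \<ge> 1\<close>. Degree two gives \<open>x w \<le> 2/5\<close> and a cost of at least
  \<open>6/5\<close>. For degree three or more, either all neighbours lie outside the star, which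
  makes \<open>x w\<close> small, or a neighbour in the star yields a five-cycle; both are
  impossible.\<close>

lemma B_degree:
  assumes w: "w \<in> B"
  shows "dA w = 1" "l * x w \<le> 1"
proof -
  obtain c where c: "center c" using exists_center by blast
  have le: "l * x w \<le> dA w" using B_eigen[OF w] sum_x_le[OF NA_V, of w] by (simp add: dA_def)
  have x0: "x w \<ge> 0" using x_nonneg B_V w by blast
  have l5: "5 * x w \<le> l * x w" using l_gt x0 by (intro mult_right_mono) auto
  have I0: "sum x (A - star c) \<ge> 0" using A_V by (intro sum_x_nonneg) auto
  have "dA w * (1 - x w) \<le> (\<Sum>w\<in>B. dA w * (1 - x w))"
    by (rule member_le_sum[OF w]) (use B_terms_nonneg in auto)
  then have lt: "dA w * (1 - x w) < 1" and I1: "sum x (A - star c) < 1"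
    using outside_excess_lt_1[OF c] I0 B_terms_nonneg(2)[OF w] by linarith+
  have "nbrs V E w = NA w"
  proof -
    have "NB w = {}" "(w, u) \<notin> E"
      using B_independent[OF w] w E_symD A_iff by (auto simp: B_def simp del: in_nbrs)
    moreover have "V \<subseteq> insert u (A \<union> B)" by (auto simp: B_def)
    ultimately show ?thesis using A_V by (force simp: nbrs_def)
  qed
  then have "NA w \<noteq> {}" using nonisolated[OF B_V[OF w]] by simp
  then obtain p where p: "p \<in> NA w" by blast
  have "dA w \<ge> 1" by (rule dA_pos[OF p])
  then show "dA w = 1"
  proof (cases w rule: dA_cases)
    case 3
    consider "card (NA w) = 2" | "card (NA w) \<ge> 3" using 3 unfolding dA_def by linarith
    then have False
    proof cases
      case 1
      then have "x w \<le> 2/5" "dA w = 2" using le l5 by (simp_all add: dA_def)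
      then show False using lt by simp
    next
      case 2
      have small: False if "x w \<le> 1/5"
      proof -
        have "3 * (4/5) \<le> dA w * (1 - x w)"
          using 2 that by (intro mult_mono) (simp_all add: dA_def)
        then show False using lt by simp
      qed
      show False
      proof (cases "NA w \<subseteq> A - star c")
        case True
        \<comment> \<open>The entries outside the star sum to less than \<open>1\<close>, so
          \<open>l * x w < 1\<close> and \<open>x w \<le> 1/5\<close>.\<close>
        then have "sum x (NA w) \<le> sum x (A - star c)"
          by (intro sum_mono2) (use x_nonneg A_V in auto)
        then show False using small I1 B_eigen[OF w] l5 by simp
      next
        case False
        then obtain v where v: "v \<in> NA w" "v \<notin> A - star c" by blast
        moreover from v(1) have "v \<in> A" by simp
        ultimately have v: "v \<in> NA w" "v \<in> star c" by blast+
        obtain y where y: "y \<in> NA v"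
        proof (cases "v = c")
          case True
          then have "dA v \<ge> 1" using c by (simp add: center_def)
          then have "NA v \<noteq> {}" by (auto simp: dA_def simp del: in_nbrs)
          then show thesis using that by blast
        next
          case False
          then have "v \<in> NA c" using v by blast
          then show thesis using that star_leaf[OF c, of v] by blast
        qed
        \<comment> \<open>With \<open>y\<close> a neighbour of \<open>v\<close> in \<open>A\<close>,
          a third neighbour \<open>v'\<close> of \<open>w\<close> completes the cycle
          \<open>u y v w v'\<close>.\<close>
        have "\<not> NA w \<subseteq> {v, y}"
        proof
          assume "NA w \<subseteq> {v, y}"
          then have "card (NA w) \<le> card {v, y}" by (intro card_mono) auto
          also have "\<dots> \<le> 2" by (simp add: card_insert_if)
          finally show False using 2 by simp
        qed
        then obtain v' where v': "v' \<in> NA w" "v' \<noteq> v" "v' \<noteq> y" by blast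
        have "y \<in> A" "v \<in> A" "v' \<in> A" "(v, y) \<in> E" "(w, v) \<in> E" "(w, v') \<in> E"
          using v(1) y v'(1) by simp_all
        then have "(u, y) \<in> E" "(y, v) \<in> E" "(v, w) \<in> E" "(w, v') \<in> E" "(v', u) \<in> E"
          using A_iff E_symD by blast+
        moreover have "y \<noteq> v" using \<open>(y, v) \<in> E\<close> irr by blast
        moreover have "w \<notin> A" "w \<noteq> u" using w by (simp_all add: B_def)
        moreover note \<open>y \<in> A\<close> \<open>v \<in> A\<close> \<open>v' \<in> A\<close> u_notin(1) v'(2,3)
        ultimately have "distinct [u, y, v, w, v']" by auto
        moreover have "\<not> distinct [u, y, v, w, v']"
          by (rule c5_free) fact+
        ultimately show False by blast
      qed
    qed
    then show ?thesis ..
  qed simp_all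
  then show "l * x w \<le> 1" using le by simp
qed

lemma B_excess: "w \<in> B \<Longrightarrow> 4/5 \<le> dA w * (1 - x w)"
proof -
  assume w: "w \<in> B"
  have "5 * x w \<le> l * x w" using l_gt x_nonneg[OF B_V[OF w]] by (intro mult_right_mono) auto
  then show ?thesis using B_degree[OF w] by simp
qed

text \<open>Each vertex of \<open>B\<close> costs at least \<open>4/5\<close>, and less than
  \<open>1\<close> is available.\<close>

lemma B_singleton:
  assumes w: "w \<in> B"
  shows "B = {w}"
proof -
  obtain c where c: "center c" using exists_center by blast
  have "sum x (A - star c) \<ge> 0" using A_V by (intro sum_x_nonneg) auto
  then have "(\<Sum>w\<in>B. dA w * (1 - x w)) < 1" using outside_excess_lt_1[OF c] by linarith
  moreover have "(\<Sum>w\<in>B. 4/5) \<le> (\<Sum>w\<in>B. dA w * (1 - x w))" by (intro sum_mono B_excess)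
  ultimately have "card B * (4/5) < (1::real)" by simp
  then have "card B \<le> 1" by simp
  then show ?thesis using w by (auto simp: card_le_Suc0_iff_eq)
qed

lemma sum_dA_A:
  assumes c: "center c"
  shows "(\<Sum>v\<in>A. dA v) = 2 * card (NA c)"
proof -
  have "(\<Sum>v\<in>A. dA v) = (\<Sum>v\<in>star c. dA v)"
    by (rule sum.mono_neutral_right) (use star_subset[OF c] star_unique[OF c] in auto)
  also have "\<dots> = dA c + (\<Sum>v\<in>NA c. dA v)" using irr by (intro sum.insert) auto
  also have "(\<Sum>v\<in>NA c. dA v) = (\<Sum>v\<in>NA c. 1)"
    using c by (intro sum.cong) (auto simp: center_def simp del: in_nbrs)
  finally show ?thesis by (simp add: dA_def)
qed

lemma card_A:
  assumes c: "center c"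
  shows "card A = 1 + card (NA c) + card (A - star c)"
proof -
  have "card (star c) = Suc (card (NA c))" using irr by (intro card_insert_disjoint) auto
  moreover have "card (A - star c) = card A - card (star c)"
    using star_subset[OF c] by (intro card_Diff_subset) auto
  moreover have "card (star c) \<le> card A" using star_subset[OF c] by (intro card_mono) auto
  ultimately show ?thesis by simp
qed

text \<open>For even \<open>m\<close> the star and a vertex \<open>w\<close> of \<open>B\<close>
  cost at least \<open>1 + 4/5 > 3/2\<close>. For odd \<open>m\<close> a parity count provides a
  vertex \<open>v\<close> isolated in \<open>G[A]\<close>; since
  \<open>l * x v \<ge> 1 \<ge> l * x w\<close>, the cost \<open>x v + (1 - x w)\<close> beyond the
  star is at least \<open>1\<close>.\<close>

lemma B_empty:
  assumes "even m \<Longrightarrow> real m - l\<^sup>2 + l < 3/2"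
  shows "B = {}"
proof (rule ccontr)
  assume "B \<noteq> {}"
  then obtain w where w: "w \<in> B" by blast
  have B: "B = {w}" by (rule B_singleton[OF w])
  obtain c where c: "center c" using exists_center by blast
  have "dB w = 0" using B_independent[OF w] by (simp add: dB_def)
  then have "2 * real m = 2 * real (card A) + 2 * card (NA c) + 2"
    using edge_count sum_dA_A[OF c] B_degree(1)[OF w] B by simp
  then have m: "m = 2 * card (NA c) + card (A - star c) + 2"
    using card_A[OF c] by linarith
  have I0: "sum x (A - star c) \<ge> 0" using A_V by (intro sum_x_nonneg) auto
  have "even m \<Longrightarrow> False"
    using outside_excess[OF c] B_excess[OF w] assms B I0 \<open>dB w = 0\<close> by simp
  then have "odd (card (A - star c))" using m by auto
  then have "A - star c \<noteq> {}" by (metis card.empty even_zero)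
  then obtain v where v: "v \<in> A - star c" by blast
  have "x v \<le> sum x (A - star c)"
    by (rule member_le_sum) (use v x_nonneg A_V in auto)
  moreover have "l * x v \<ge> 1"
    using eigen_A[of v] v sum_x_nonneg[OF NA_V, of v] sum_x_nonneg[OF NB_V, of v] by simp
  then have "l * x w \<le> l * x v" using B_degree(2)[OF w] by linarith
  then have "x w \<le> x v" using l_gt by simp
  moreover have "sum x (A - star c) + (1 - x w) < 1"
    using outside_excess_lt_1[OF c] B B_degree(1)[OF w] by simp
  ultimately show False by linarith
qed

text \<open>\<open>L\<close> consists of the leaves of the star and \<open>I\<close> of the isolated
  vertices of \<open>G[A]\<close>. With \<open>p = x c\<close>, leaves have entry
  \<open>(1 + p) / l\<close> and vertices of \<open>I\<close> have \<open>1 / l\<close>; the quartic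
  results from eliminating \<open>p\<close> from the equations at \<open>c\<close>
  (\<open>e1\<close>) and \<open>u\<close> (\<open>e2\<close>).\<close>

lemma pendant_structure:
  assumes "even m \<Longrightarrow> real m - l\<^sup>2 + l < 3/2"
  obtains c L I where "pendant_form V E u c L I" "L \<noteq> {}" "m = 2 * card L + card I + 1"
    "(l\<^sup>2 - card L - card I) * (l\<^sup>2 - card L) = (l + card L)\<^sup>2"
proof -
  obtain c where c: "center c" using exists_center by blast
  define L where "L = NA c"
  define I where "I = A - star c"
  have cA: "c \<in> A" using c by (simp add: center_def)
  have B: "B = {}" using assms by (rule B_empty)
  have A: "A = insert c (L \<union> I)" using star_subset[OF c] by (auto simp: L_def I_def)
  have A_mem: "v \<in> A \<longleftrightarrow> v = c \<or> v \<in> L \<or> v \<in> I" for v by (subst A) simp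
  have NL: "NA v = {c}" if "v \<in> L" for v using star_leaf[OF c] that by (simp add: L_def del: in_nbrs)
  have NI: "NA v = {}" if "v \<in> I" for v
    using star_unique[OF c, of v] that dA_zero[of v] by (simp add: I_def del: in_nbrs)
  have disj: "c \<notin> L" "c \<notin> I" "L \<inter> I = {}" and fLI: "finite L" "finite I"
    using irr by (auto simp: L_def I_def)
  have V: "V = insert u A" using B u A_V by (auto simp: B_def)
  have V_mem: "v \<in> V \<longleftrightarrow> v = u \<or> v \<in> A" for v using V by blast
  have "(v, w) \<in> E \<longleftrightarrow> (v, w) \<in> {(u, c), (c, u)} \<union> {u} \<times> (L \<union> I) \<union> (L \<union> I) \<times> {u} \<union> {c} \<times> L \<union> L \<times> {c}"
    (is "_ \<longleftrightarrow> _ \<in> ?R") for v w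
  proof
    assume e: "(v, w) \<in> E"
    then have vw: "v \<in> V" "w \<in> V" "v \<noteq> w" using sub irr by blast+
    show "(v, w) \<in> ?R"
    proof (cases "v = u \<or> w = u")
      case True
      have "v = u \<or> v = c \<or> v \<in> L \<or> v \<in> I" "w = u \<or> w = c \<or> w \<in> L \<or> w \<in> I"
        using vw(1,2) V_mem A_mem by blast+
      then show ?thesis using True vw(3) by blast
    next
      case False
      then have v: "v \<in> A" "w \<in> NA v" using vw(1,2) V_mem e by auto
      then consider "v = c" | "v \<in> L" | "v \<in> I" using A_mem by blast
      then show ?thesis
      proof cases
        case 1
        then have "w \<in> L" using v by (simp add: L_def)
        then show ?thesis using 1 by simp
      next
        case 2
        then show ?thesis using v NL[OF 2] by simp
      next
        case 3
        then show ?thesis using v NI[OF 3] by simp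
      qed
    qed
  next
    have *: "(u, v) \<in> E \<and> (v, u) \<in> E" if "v \<in> A" for v using that A_iff E_symD by blast
    have **: "(c, v) \<in> E \<and> (v, c) \<in> E" if "v \<in> L" for v using that E_symD by (auto simp: L_def)
    assume "(v, w) \<in> ?R"
    then consider "v = u" "w \<in> A" | "w = u" "v \<in> A" | "v = c" "w \<in> L" | "w = c" "v \<in> L"
      using A_mem by blast
    then show "(v, w) \<in> E" by cases (simp_all add: * **)
  qed
  then have "E = {(u, c), (c, u)} \<union> {u} \<times> (L \<union> I) \<union> (L \<union> I) \<times> {u} \<union> {c} \<times> L \<union> L \<times> {c}"
    by (intro equalityI subrelI) simp_all
  moreover have "u \<noteq> c" "u \<notin> L \<union> I" using u_notin(1) A_mem by blast+
  moreover have "V = insert u (insert c (L \<union> I))" using V A by metis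
  ultimately have form: "pendant_form V E u c L I"
    unfolding pendant_form_def using disj fLI by (intro conjI) simp_all
  have "dA c \<ge> 1" using c by (simp add: center_def)
  then have ne: "L \<noteq> {}" by (auto simp: dA_def L_def simp del: in_nbrs)
  have "2 * real m = 2 * real (card A) + 2 * real (card L)"
    using edge_count sum_dA_A[OF c] by (simp add: B L_def)
  then have m: "m = 2 * card L + card I + 1"
    using card_A[OF c, folded I_def, folded L_def] by linarith
  define p where "p = x c"
  have NB0: "NB v = {}" for v using B by auto
  have xL: "l * x v = 1 + p" if "v \<in> L" for v
    using eigen_A[of v] that A_mem[of v] NB0[of v] NL[OF that] by (simp add: p_def)
  have xI: "l * x v = 1" if "v \<in> I" for v
    using eigen_A[of v] that A_mem[of v] NB0[of v] NI[OF that] by simp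
  have sL: "l * sum x L = card L * (1 + p)" unfolding sum_distrib_left using xL by simp
  have sI: "l * sum x I = card I" unfolding sum_distrib_left using xI by simp
  have "l * p = 1 + sum x L" using eigen_A[OF cA] NB0[of c] by (simp add: p_def L_def)
  then have "l * (l * p) = l * (1 + sum x L)" by (rule arg_cong)
  also have "\<dots> = l + card L * (1 + p)" by (simp only: distrib_left sL)
  finally have e1: "l\<^sup>2 * p = l + card L * (1 + p)" by (simp add: power2_eq_square)
  have "l = p + sum x L + sum x I"
    using eigen_u[unfolded A] disj fLI by (simp add: p_def sum.union_disjoint)
  then have "l * l = l * (p + sum x L + sum x I)" by (rule arg_cong)
  also have "\<dots> = l * p + card L * (1 + p) + card I" by (simp only: distrib_left sL sI)
  finally have e2: "l\<^sup>2 = l * p + card L * (1 + p) + card I" by (simp add: power2_eq_square)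
  have "(l\<^sup>2 - card L - card I) * (l\<^sup>2 - card L) = (l + card L) * (p * (l\<^sup>2 - card L))"
    using e2 by (simp add: algebra_simps)
  also have "p * (l\<^sup>2 - card L) = l + card L"
    using e1 by (simp add: algebra_simps)
  finally have "(l\<^sup>2 - card L - card I) * (l\<^sup>2 - card L) = (l + card L)\<^sup>2" by (simp add: power2_eq_square)
  then show thesis using that form ne m by blast
qed

end

subsection \<open>The graphs \<open>S\<^sup>t\<^bsub>n,2\<^esub>\<close>\<close>

lemma pair_graph_imp_wf: "pair_graph G \<Longrightarrow> pair_wf_digraph G"
proof -
  assume "pair_graph G"
  then interpret pair_graph G .
  show ?thesis by unfold_locales
qed

text \<open>Adjacency is expressed through membership in the classes \<open>u\<close>,
  \<open>c\<close>, \<open>L\<close> and \<open>V\<close> alone, so a bijection respecting these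
  classes is an isomorphism.\<close>

lemma pendant_form_adj:
  assumes "pendant_form V E u c L I"
  shows "(v, w) \<in> E \<longleftrightarrow> (v = u \<and> w \<in> V \<and> w \<noteq> u) \<or> (w = u \<and> v \<in> V \<and> v \<noteq> u)
    \<or> (v = c \<and> w \<in> L) \<or> (w = c \<and> v \<in> L)"
proof -
  have d: "u \<noteq> c" "u \<notin> L" "u \<notin> I" "c \<notin> L" and V: "V = insert u (insert c (L \<union> I))"
    and E: "E = {(u, c), (c, u)} \<union> {u} \<times> (L \<union> I) \<union> (L \<union> I) \<times> {u} \<union> {c} \<times> L \<union> L \<times> {c}"
    using assms by (simp_all add: pendant_form_def)
  have "(v, w) \<in> E \<longleftrightarrow> (v = u \<and> w = c) \<or> (v = c \<and> w = u) \<or> (v = u \<and> (w \<in> L \<or> w \<in> I))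
      \<or> ((v \<in> L \<or> v \<in> I) \<and> w = u) \<or> (v = c \<and> w \<in> L) \<or> (v \<in> L \<and> w = c)"
    unfolding E by simp
  moreover have mem: "y \<in> V \<longleftrightarrow> y = u \<or> y = c \<or> y \<in> L \<or> y \<in> I" for y
    unfolding V by simp
  ultimately show ?thesis using d unfolding mem[of v] mem[of w]
    by (cases "v = u"; cases "w = u"; simp; blast)
qed

lemma pendant_form_iso:
  assumes G: "pair_graph G" and H: "pair_graph H"
    and f: "pendant_form (pverts G) (parcs G) u c L I"
    and f': "pendant_form (pverts H) (parcs H) u' c' L' I'"
    and card: "card L = card L'" "card I = card I'"
  shows "graph_iso G H"
proof -
  have fin: "finite L" "finite L'" "finite I" "finite I'" using f f' by (auto simp: pendant_form_def)
  obtain g where g: "bij_betw g L L'" using finite_same_card_bij[OF fin(1,2) card(1)] by blast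
  obtain k where k: "bij_betw k I I'" using finite_same_card_bij[OF fin(3,4) card(2)] by blast
  have V: "pverts G = insert u (insert c (L \<union> I))" and V': "pverts H = insert u' (insert c' (L' \<union> I'))"
    and d: "u \<noteq> c" "u \<notin> L" "u \<notin> I" "c \<notin> L" "c \<notin> I" "L \<inter> I = {}"
    and d': "u' \<noteq> c'" "u' \<notin> L'" "u' \<notin> I'" "c' \<notin> L'" "c' \<notin> I'" "L' \<inter> I' = {}"
    using f f' by (simp_all add: pendant_form_def)
  define h where "h v = (if v = u then u' else if v = c then c' else if v \<in> L then g v else k v)" for v
  have "h v = g v" if "v \<in> L" for v using that d by (auto simp: h_def)
  then have "bij_betw h L L' = bij_betw g L L'" by (rule bij_betw_cong)
  moreover have "h v = k v" if "v \<in> I" for v using that d by (auto simp: h_def)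
  then have "bij_betw h I I' = bij_betw k I I'" by (rule bij_betw_cong)
  ultimately have "bij_betw h L L'" "bij_betw h I I'" using g k by simp_all
  moreover have "bij_betw h {u} {u'}" "bij_betw h {c} {c'}" using d by (auto simp: h_def bij_betw_def)
  ultimately have "bij_betw h ({u} \<union> ({c} \<union> (L \<union> I))) ({u'} \<union> ({c'} \<union> (L' \<union> I')))"
    by (intro bij_betw_combine) (use d' in simp_all)
  then have b: "bij_betw h (pverts G) (pverts H)"
    using V V' insert_is_Un by metis
  have hL: "h v \<in> L'" if "v \<in> L" for v
    using that bij_betwE[OF \<open>bij_betw h L L'\<close>] by blast
  have hI: "h v \<in> I'" if "v \<in> I" for v
    using that bij_betwE[OF \<open>bij_betw h I I'\<close>] by blast
  have hu: "h u = u'" and hc: "h c = c'" using d by (simp_all add: h_def)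
  have V'_mem: "y \<in> pverts H \<longleftrightarrow> y = u' \<or> y = c' \<or> y \<in> L' \<or> y \<in> I'" for y
    unfolding V' by simp
  have classes: "(h v = u' \<longleftrightarrow> v = u) \<and> (h v = c' \<longleftrightarrow> v = c) \<and> (h v \<in> L' \<longleftrightarrow> v \<in> L) \<and> h v \<in> pverts H"
    if v: "v \<in> pverts G" for v
  proof -
    consider "v = u" | "v = c" | "v \<in> L" | "v \<in> I" using v V by blast
    then show ?thesis
    proof cases
      case 1 then show ?thesis using hu d d'(1-3) V'_mem[of u'] by simp
    next
      case 2 then show ?thesis using hc d d'(1,4,5) V'_mem[of c'] by simp
    next
      case 3
      then have "h v \<in> L'" "h v \<noteq> u'" "h v \<noteq> c'" "v \<noteq> u" "v \<noteq> c" using hL[OF 3] d d' by blast+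
      then show ?thesis using 3 V'_mem[of "h v"] by simp
    next
      case 4
      then have "h v \<in> I'" "h v \<notin> L'" "h v \<noteq> u'" "h v \<noteq> c'" "v \<noteq> u" "v \<noteq> c" "v \<notin> L"
        using hI[OF 4] d d' by blast+
      then show ?thesis using V'_mem[of "h v"] by simp
    qed
  qed
  have "(v, w) \<in> parcs G \<longleftrightarrow> (h v, h w) \<in> parcs H" if "v \<in> pverts G" "w \<in> pverts G" for v w
    unfolding pendant_form_adj[OF f, of v w] pendant_form_adj[OF f', of "h v" "h w"]
    by (simp only: classes[OF that(1)] classes[OF that(2)] that)
  then show ?thesis
    unfolding graph_iso_iff[OF pair_graph_imp_wf[OF G] pair_graph_imp_wf[OF H]] using b by auto
qed

text \<open>An eigenvector of \<open>H\<close> composed with the isomorphism is an eigenvector of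
  \<open>G\<close>.\<close>

lemma eigenvalue_iso:
  assumes G: "pair_graph G" and H: "pair_graph H" and "graph_iso G H"
    and z: "v \<in> pverts H" "z v \<noteq> 0"
      "\<And>v. v \<in> pverts H \<Longrightarrow> (\<Sum>y \<in> nbrs (pverts H) (parcs H) v. z y) = l * z v"
  shows "l \<le> largest_eigenvalue G"
proof -
  obtain f where f: "bij_betw f (pverts G) (pverts H)"
    and e: "\<And>u v. u \<in> pverts G \<Longrightarrow> v \<in> pverts G \<Longrightarrow> (u, v) \<in> parcs G \<longleftrightarrow> (f u, f v) \<in> parcs H"
    using assms(3) graph_iso_iff[OF pair_graph_imp_wf[OF G] pair_graph_imp_wf[OF H]] by blast
  have "v \<in> f ` pverts G" using f z(1) by (simp add: bij_betw_def)
  then obtain u where u: "u \<in> pverts G" "f u = v" by blast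
  show ?thesis
  proof (rule eigenvalue_le_largest[OF G u(1), of "z \<circ> f"])
    fix w assume w: "w \<in> pverts G"
    then have fw: "f w \<in> pverts H" using bij_betwE[OF f] by blast
    have "bij_betw f (nbrs (pverts G) (parcs G) w) (nbrs (pverts H) (parcs H) (f w))"
      unfolding bij_betw_def
    proof
      show "inj_on f (nbrs (pverts G) (parcs G) w)"
        using f by (auto simp: bij_betw_def inj_on_def)
      have "f ` pverts G = pverts H" using f by (simp add: bij_betw_def)
      then have "nbrs (pverts H) (parcs H) (f w) = f ` {v \<in> pverts G. (f w, f v) \<in> parcs H}"
        by (auto simp: nbrs_def)
      also have "{v \<in> pverts G. (f w, f v) \<in> parcs H} = nbrs (pverts G) (parcs G) w"
        using e[OF w] by (auto simp: nbrs_def)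
      finally show "f ` nbrs (pverts G) (parcs G) w = nbrs (pverts H) (parcs H) (f w)" ..
    qed
    from sum.reindex_bij_betw[OF this, of z]
    show "(\<Sum>y\<in>nbrs (pverts G) (parcs G) w. (z \<circ> f) y) = l * (z \<circ> f) w"
      using z(3)[OF fw] by simp
  qed (use u z in auto)
qed

text \<open>Reverses the elimination in \<open>pendant_structure\<close>: a positive root of the
  quartic is an eigenvalue.\<close>

lemma pendant_form_eigenvector:
  fixes q :: real
  assumes f: "pendant_form V E u c L I" and q: "q > 0"
    and root: "(q\<^sup>2 - card L - card I) * (q\<^sup>2 - card L) = (q + card L)\<^sup>2"
  obtains z where "z u = 1" "\<And>v. v \<in> V \<Longrightarrow> (\<Sum>y \<in> nbrs V E v. z y) = q * z v"
proof -
  note F = f[unfolded pendant_form_def]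
  define r t where "r = real (card L)" and "t = real (card I)"
  \<comment> \<open>Chosen to solve the equation at \<open>u\<close>; the quartic then yields the
    equation at \<open>c\<close> (\<open>p2\<close>) after cancelling \<open>q + r\<close>.\<close>
  define p where "p = (q\<^sup>2 - r - t) / (q + r)"
  have qr: "q + r > 0" using q by (simp add: r_def)
  then have p1: "(q + r) * p = q\<^sup>2 - r - t" by (simp add: p_def)
  then have "(q + r) * (p * (q\<^sup>2 - r)) = (q + r) * (q + r)"
    using root by (simp add: r_def t_def power2_eq_square mult.assoc[symmetric])
  then have p2: "p * (q\<^sup>2 - r) = q + r" using qr by simp
  define z where "z v = (if v = u then 1 else if v = c then p else if v \<in> L then (1 + p) / q else 1 / q)" for v
  have zL: "sum z L = r * ((1 + p) / q)"
  proof -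
    have "sum z L = (\<Sum>v\<in>L. (1 + p) / q)" using F by (intro sum.cong) (auto simp: z_def)
    then show ?thesis by (simp add: r_def)
  qed
  have zI: "sum z I = t * (1 / q)"
  proof -
    have "sum z I = (\<Sum>v\<in>I. 1 / q)" using F by (intro sum.cong) (auto simp: z_def)
    then show ?thesis by (simp add: t_def)
  qed
  have zu: "z u = 1" and zc: "z c = p" using F by (auto simp: z_def)
  have adj: "nbrs V E u = insert c (L \<union> I)" "nbrs V E c = insert u L"
    "\<And>v. v \<in> L \<Longrightarrow> nbrs V E v = {u, c}" "\<And>v. v \<in> I \<Longrightarrow> nbrs V E v = {u}"
    using F by (auto simp: nbrs_def)
  have "(\<Sum>y \<in> nbrs V E v. z y) = q * z v" if v: "v \<in> V" for v
  proof -
    consider "v = u" | "v = c" | "v \<in> L" | "v \<in> I" using v F by blast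
    then show ?thesis
    proof cases
      case 1
      have "sum z (insert c (L \<union> I)) = p + (sum z L + sum z I)"
        using F zc by (simp add: sum.union_disjoint)
      also have "\<dots> = q" using p1 q unfolding zL zI
        by (simp add: field_simps power2_eq_square)
      finally show ?thesis using 1 adj zu by simp
    next
      case 2
      have "sum z (insert u L) = 1 + sum z L" using F zu by simp
      also have "\<dots> = q * p" using p2 q unfolding zL
        by (simp add: field_simps power2_eq_square)
      finally show ?thesis using 2 adj zc by simp
    next
      case 3
      then have "v \<noteq> u" "v \<noteq> c" using F by auto
      then have "q * z v = 1 + p" using 3 q by (simp add: z_def)
      moreover have "u \<noteq> c" using F by blast
      ultimately show ?thesis using adj(3)[OF 3] zu zc by simp
    next
      case 4
      then have "v \<noteq> u" "v \<noteq> c" "v \<notin> L" using F by auto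
      then have "q * z v = 1" using q by (simp add: z_def)
      then show ?thesis using adj(4)[OF 4] zu by simp
    qed
  qed
  then show thesis using that zu by blast
qed

lemma parcs_complete_split:
  "pverts (complete_split (r + 2) 2) = {Inl 0, Inl 1} \<union> Inr ` {..<r}"
  "parcs (complete_split (r + 2) 2) = {(Inl 0, Inl 1), (Inl 1, Inl 0)} \<union> {Inl 0, Inl 1} \<times> Inr ` {..<r}
     \<union> Inr ` {..<r} \<times> {Inl 0, Inl 1}"
proof -
  have "{..<2::nat} = {0, 1}" by auto
  then show "pverts (complete_split (r + 2) 2) = {Inl 0, Inl 1} \<union> Inr ` {..<r}"
    by (auto simp: complete_split_def join_def complete_graph_def empty_graph_def)
  show "parcs (complete_split (r + 2) 2) = {(Inl 0, Inl 1), (Inl 1, Inl 0)} \<union> {Inl 0, Inl 1} \<times> Inr ` {..<r}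
     \<union> Inr ` {..<r} \<times> {Inl 0, Inl 1}"
    by (auto simp: complete_split_def join_def complete_graph_def empty_graph_def less_2_cases_iff)
qed

lemma pendant_form_complete_split:
  "pendant_form (pverts (complete_split (r + 2) 2)) (parcs (complete_split (r + 2) 2))
     (Inl 0) (Inl 1) (Inr ` {..<r}) {}"
  unfolding pendant_form_def parcs_complete_split by auto

text \<open>The vertices \<open>Inl 0\<close> and \<open>Inl 1\<close> have degree
  \<open>r + 1 > 2\<close>, the others at most \<open>2\<close>. Which of the two
  \<open>arg_max_on\<close> picks stays open.\<close>

lemma max_degree_complete_split:
  assumes "r \<ge> 2"
  defines "S \<equiv> complete_split (r + 2) 2"
  shows "arg_max_on (out_degree (with_proj S)) (pverts S) \<in> {Inl 0, Inl 1}"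
proof -
  note P = parcs_complete_split[of r, folded S_def]
  let ?d = "out_degree (with_proj S)"
  let ?w = "arg_max_on ?d (pverts S)"
  have fin: "finite (pverts S)" by (simp add: P)
  have "?w \<in> pverts S \<and> (\<forall>y. y \<in> pverts S \<longrightarrow> ?d y \<le> ?d ?w)"
    unfolding arg_max_on_def
  proof (rule arg_max_nat_lemma)
    show "Inl 0 \<in> pverts S" by (simp add: P)
    show "\<forall>y. y \<in> pverts S \<longrightarrow> ?d y < Suc (Max (?d ` pverts S))"
      using fin by (auto simp: less_Suc_eq_le)
  qed
  moreover have "Inl 0 \<in> pverts S" by (simp add: P)
  ultimately have w: "?w \<in> pverts S" "?d (Inl 0) \<le> ?d ?w" by blast+
  have "(\<lambda>a. (Inl 0, a)) ` insert (Inl 1) (Inr ` {..<r}) \<subseteq> out_arcs (with_proj S) (Inl 0)"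
    by (auto simp: P out_arcs_def)
  moreover have "finite (out_arcs (with_proj S) (Inl 0))"
    by (rule finite_subset[of _ "parcs S"]) (auto simp: out_arcs_def P)
  moreover have "card ((\<lambda>a. (Inl 0 :: nat + nat, a)) ` insert (Inl 1) (Inr ` {..<r})) = r + 1"
    by (subst card_image) (simp add: inj_on_def, simp add: card_insert_if card_image image_iff)
  ultimately have "?d (Inl 0) \<ge> r + 1" unfolding out_degree_def by (metis card_mono)
  moreover have "?d (Inr j) \<le> 2" for j
  proof -
    have "out_arcs (with_proj S) (Inr j) \<subseteq> {(Inr j, Inl 0), (Inr j, Inl 1)}"
      by (auto simp: P out_arcs_def)
    then have "?d (Inr j) \<le> card {(Inr j :: nat + nat, Inl 0 :: nat + nat), (Inr j, Inl 1)}"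
      unfolding out_degree_def by (intro card_mono) auto
    then show ?thesis by (simp add: card_insert_if)
  qed
  ultimately have "?w \<noteq> Inr j" for j using w(2) assms(1) by (metis add_leE le_trans not_less_eq_eq numeral_2_eq_2 Suc_eq_plus1)
  then show ?thesis using w(1) by (auto simp: P)
qed

lemma pendant_form_pendant_split:
  assumes "r \<ge> 2"
  obtains u c L I where
    "pendant_form (pverts (pendant_split t (r + 2 + t) 2)) (parcs (pendant_split t (r + 2 + t) 2)) u c L I"
    "card L = r" "card I = t"
proof -
  define S where "S = complete_split (r + 2) 2"
  define w where "w = arg_max_on (out_degree (with_proj S)) (pverts S)"
  have w: "w = Inl 0 \<or> w = Inl 1" using max_degree_complete_split[OF assms] by (simp add: w_def S_def)
  \<comment> \<open>The dominating vertex that was not picked plays the role of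
    \<open>c\<close>.\<close>
  define w' where "w' = (if w = Inl 0 then Inl 1 else Inl 0 :: nat + nat)"
  have P: "pendant_split t (r + 2 + t) 2 = attach_pendants t w S"
    by (simp only: pendant_split_def Let_def w_def S_def diff_add_inverse2)
  have "pendant_form (pverts (attach_pendants t w S)) (parcs (attach_pendants t w S))
      (Inl w) (Inl w') (Inl ` Inr ` {..<r}) (Inr ` {..<t})"
    using w unfolding pendant_form_def attach_pendants_def S_def parcs_complete_split w'_def
    by (elim disjE) auto
  moreover have "card (Inl ` Inr ` {..<r}) = r" "card (Inr ` {..<t}) = t"
    by (simp_all add: card_image)
  ultimately show thesis using that P by metis
qed

subsection \<open>The zeros of \<open>\<psi>\<^sub>1\<close>\<close>

text \<open>\<open>psi1\<close> is the characteristic polynomial of the quotient of the extremal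
  graph by its four vertex classes, with \<open>t = 1\<close> for even and \<open>t = 2\<close> for
  odd \<open>m\<close>.\<close>

lemma psi1_pendant:
  assumes "m = 2 * r + t + 1" and "even m \<longleftrightarrow> t = 1" "odd m \<longleftrightarrow> t = 2"
  shows "psi1 m x = (x\<^sup>2 - real r - real t) * (x\<^sup>2 - real r) - (x + real r)\<^sup>2"
  using assms by (cases "even m") (auto simp: psi1_def algebra_simps power2_eq_square power4_eq_xxxx)

text \<open>Compares the quartic for \<open>t\<close> pendant vertices with \<open>psi1\<close>: at
  a root above \<open>1\<close> the sign of \<open>psi1\<close> is that of \<open>1 - t\<close> or
  \<open>2 - t\<close>.\<close>

lemma psi1_diff:
  assumes m: "m = 2 * r + t + 1" and root: "(x\<^sup>2 - real r - real t) * (x\<^sup>2 - real r) = (x + real r)\<^sup>2"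
  shows "psi1 m x = (if even m then (1 - real t) * (x + real r - 1/2) else (2 - real t) * (x + real r - 1))"
proof -
  have "x ^ 4 = real m * x\<^sup>2 + 2 * real r * x - real r * real t"
    using root m by (simp add: algebra_simps power2_eq_square power4_eq_xxxx)
  then show ?thesis using m by (simp add: psi1_def field_simps)
qed

lemma psi1_nonneg_large:
  assumes m: "m \<ge> 22" and z: "z \<ge> real m"
  shows "psi1 m z \<ge> 0"
proof -
  define r where "r = real m"
  have r: "r \<ge> 22" "r \<le> z" using m z by (auto simp: r_def)
  have 2: "22 * z \<le> z * z" using r by (intro mult_right_mono) auto
  have 3: "22 * (z * z) \<le> z * (z * z)" using r by (intro mult_right_mono) auto
  have 4: "22 * (z * (z * z)) \<le> z * (z * (z * z))" using r by (intro mult_right_mono) auto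
  have 5: "r * (z * z) \<le> z * (z * z)" "r * z \<le> z * z" using r by (intro mult_right_mono; auto)+
  have "0 \<le> z ^ 4 - r * z ^ 2 - (r - 2) * z + r / 2 - 1" "0 \<le> z ^ 4 - r * z ^ 2 - (r - 3) * z + r - 3"
    unfolding power2_eq_square power4_eq_xxxx left_diff_distrib mult.assoc
    using r 2 3 4 5 by linarith+
  then show ?thesis by (simp add: psi1_def r_def)
qed

lemma continuous_psi1: "continuous_on S (psi1 m)"
proof -
  have "continuous_on S (\<lambda>x. x ^ 4 - real m * x ^ 2 - (real m - 2) * x + real m / 2 - 1)"
    "continuous_on S (\<lambda>x. x ^ 4 - real m * x ^ 2 - (real m - 3) * x + real m - 3)"
    by (intro continuous_intros)+
  then show ?thesis unfolding psi1_def by (cases "even m") simp_all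
qed

lemma le_rho1: "psi1 m y = 0 \<Longrightarrow> y \<le> rho1 m"
  unfolding rho1_def by (rule Max_ge[OF finite_zeros_psi1]) simp

text \<open>\<open>psi1\<close> is nonnegative from \<open>real m\<close> on, so the intermediate
  value theorem places a zero to the right of \<open>y\<close>.\<close>

lemma less_rho1:
  assumes m: "m \<ge> 22" and y: "psi1 m y < 0"
  shows "y < rho1 m"
proof -
  have "\<exists>x \<ge> y. x \<le> max y (real m) \<and> psi1 m x = 0"
  proof (rule IVT')
    have "y < real m" using psi1_nonneg_large[OF m, of y] y by linarith
    then show "0 \<le> psi1 m (max y (real m))" using psi1_nonneg_large[OF m, of "real m"] by simp
  qed (use y continuous_psi1 in auto)
  then obtain x where "x \<ge> y" "psi1 m x = 0" by blast
  moreover from this have "x \<noteq> y" using y by auto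
  ultimately show ?thesis using le_rho1[of m x] by simp
qed

lemma psi1_rho1: "m \<ge> 22 \<Longrightarrow> psi1 m (rho1 m) = 0"
  unfolding rho1_def using Max_in[OF finite_zeros_psi1 zeros_psi1_nonempty] by blast

text \<open>\<open>psi1\<close> is negative at the point \<open>y\<close> below, so
  \<open>y < l\<close>. As \<open>y \<ge> 1/2\<close>, where \<open>l^2 - l\<close> is increasing,
  \<open>l^2 - l\<close> exceeds \<open>y^2 - y = m - d\<close>.\<close>

lemma rho1_bounds:
  assumes m: "m \<ge> 22" and l: "l \<ge> rho1 m"
  shows "l > 5" "real m - l\<^sup>2 + l < 2" "even m \<Longrightarrow> real m - l\<^sup>2 + l < 3/2"
proof -
  \<comment> \<open>\<open>y\<close> is the positive root of \<open>y\<^sup>2 - y = m - d\<close>, where \<open>\<psi>\<^sub>1\<close> is \<open>- 1/4\<close> or \<open>- 1\<close>.\<close>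
  define d where "d = (if even m then 3/2 else 2 :: real)"
  have d: "d \<le> 2" by (simp add: d_def)
  define y where "y = (1 + sqrt (1 + 4 * (real m - d))) / 2"
  have s: "(sqrt (1 + 4 * (real m - d)))\<^sup>2 = 1 + 4 * (real m - d)" using m d by simp
  have y: "y\<^sup>2 - y = real m - d"
    using s unfolding y_def by (simp add: power2_eq_square field_simps)
  have y0: "y \<ge> 1/2" using m d by (simp add: y_def)
  \<comment> \<open>Division of \<open>psi1\<close> by \<open>y^2 - y - (m - 1)\<close>, whose value
    at \<open>y\<close> is \<open>1 - d\<close>.\<close>
  have q: "psi1 m y = (if even m then (y\<^sup>2 - y - (real m - 1)) * (y\<^sup>2 + y) + y + real m / 2 - 1
      else (y\<^sup>2 - y - (real m - 1)) * (y\<^sup>2 + y) + 2 * y + real m - 3)"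
    by (simp add: psi1_def power2_eq_square power4_eq_xxxx algebra_simps)
  have y1: "y\<^sup>2 - y - (real m - 1) = 1 - d" using y by simp
  have "psi1 m y < 0"
  proof (cases "even m")
    case True
    then have "psi1 m y = - (1/2) * (y\<^sup>2 - y) + real m / 2 - 1"
      unfolding q y1 by (simp add: d_def algebra_simps)
    then show ?thesis using y True by (simp add: d_def field_simps)
  next
    case False
    then have "psi1 m y = - (y\<^sup>2 - y) + real m - 3"
      unfolding q y1 by (simp add: d_def algebra_simps)
    then show ?thesis using y False by (simp add: d_def)
  qed
  then have yl: "y < l" using less_rho1[OF m] l by fastforce
  have "0 < (l - y) * (l + y - 1)" using yl y0 by (intro mult_pos_pos) auto
  then have gt: "l\<^sup>2 - l > real m - d" using y by (simp add: power2_eq_square algebra_simps)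
  then show "real m - l\<^sup>2 + l < 2" using d by simp
  show "real m - l\<^sup>2 + l < 3/2" if "even m" using gt that by (simp add: d_def)
  show "l > 5"
  proof (rule ccontr)
    assume "\<not> l > 5"
    \<comment> \<open>The product is \<open>l^2 - l - 20\<close>, while
      \<open>m - d \<ge> 20\<close>.\<close>
    then have "(l - 5) * (l + 4) \<le> 0" using yl y0 by (intro mult_nonpos_nonneg) auto
    then show False using gt d m by (simp add: power2_eq_square algebra_simps)
  qed
qed

subsection \<open>Graphs with large spectral radius\<close>

lemma contains_c5:
  assumes G: "pair_graph G"
    and e: "(a0, a1) \<in> parcs G" "(a1, a2) \<in> parcs G" "(a2, a3) \<in> parcs G" "(a3, a4) \<in> parcs G" "(a4, a0) \<in> parcs G"
    and d: "distinct [a0, a1, a2, a3, a4]"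
  shows "contains_subgraph_iso_to G (cycle_graph 5)"
proof -
  define C where "C = {(a0, a1), (a1, a2), (a2, a3), (a3, a4), (a4, a0)}"
  define H where "H = \<lparr>pverts = {a0, a1, a2, a3, a4}, parcs = C \<union> C\<inverse>\<rparr>"
  note g = pair_graph_facts[OF G]
  have sub: "C \<union> C\<inverse> \<subseteq> parcs G" using e g(2) by (auto simp: C_def dest: symD)
  have wfG: "wf_digraph (with_proj G)" using pair_graph_imp_wf[OF G] by (simp add: wf_digraph_wp_iff)
  have wfH: "pair_wf_digraph H" by (unfold_locales) (auto simp: H_def C_def)
  have "subgraph (with_proj H) (with_proj G)"
    unfolding subgraph_def
  proof (intro conjI)
    show "verts (with_proj H) \<subseteq> verts (with_proj G)" using e g(4) by (auto simp: H_def)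
    show "arcs (with_proj H) \<subseteq> arcs (with_proj G)" using sub by (simp add: H_def)
    show "wf_digraph (with_proj H)" using wfH by (simp add: wf_digraph_wp_iff)
  qed (use wfG in \<open>simp_all add: compatible_def\<close>)
  moreover have "graph_iso H (cycle_graph 5)"
  proof -
    have wfC: "pair_wf_digraph (cycle_graph 5)" by unfold_locales (auto simp: cycle_graph_def)
    have five: "{..<5::nat} = {0, 1, 2, 3, 4}" by auto
    define f where "f v = (if v = a0 then 0 else if v = a1 then 1 else if v = a2 then 2 else if v = a3 then 3 else 4 :: nat)" for v
    have f: "f a0 = 0" "f a1 = 1" "f a2 = 2" "f a3 = 3" "f a4 = 4" using d by (auto simp: f_def)
    have "bij_betw f (pverts H) (pverts (cycle_graph 5))"
      unfolding bij_betw_def by (auto simp: H_def cycle_graph_def five f inj_on_def)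
    moreover have "\<forall>u\<in>pverts H. \<forall>v\<in>pverts H. (u, v) \<in> parcs H \<longleftrightarrow> (f u, f v) \<in> parcs (cycle_graph 5)"
      using d by (simp add: H_def C_def cycle_graph_def f) auto
    ultimately show ?thesis using graph_iso_iff[OF wfH wfC] by blast
  qed
  ultimately show ?thesis unfolding contains_subgraph_iso_to_def by blast
qed

lemma card_parcs:
  assumes "pair_graph G"
  shows "card (parcs G) = 2 * card (edges G)"
proof -
  note g = pair_graph_facts[OF assms]
  let ?F = "\<lambda>e. {a \<in> parcs G. {fst a, snd a} = e}"
  have "parcs G \<subseteq> pverts G \<times> pverts G" using g(4) by auto
  then have fin: "finite (parcs G)" by (rule finite_subset) (use g(1) in simp)
  have ed: "edges G = (\<lambda>a. {fst a, snd a}) ` parcs G" by (force simp: edges_def)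
  have "parcs G = (\<Union>e\<in>edges G. ?F e)" by (auto simp: ed)
  moreover have "card (\<Union>e\<in>edges G. ?F e) = (\<Sum>e\<in>edges G. card (?F e))"
    by (rule card_UN_disjoint) (use fin in \<open>auto simp: ed\<close>)
  moreover have "card (?F e) = 2" if in_edges: "e \<in> edges G" for e
  proof -
    obtain u v where e: "e = {u, v}" "(u, v) \<in> parcs G" using in_edges unfolding edges_def by blast
    then have "(v, u) \<in> parcs G" "u \<noteq> v" using g(2,3) by (auto dest: symD)
    then have "?F e = {(u, v), (v, u)}" using e by (auto simp: doubleton_eq_iff)
    then show ?thesis using \<open>u \<noteq> v\<close> by simp
  qed
  ultimately show ?thesis by simp
qed

lemma pair_graph_pendant_split_sum: "r \<ge> 2 \<Longrightarrow> pair_graph (pendant_split t (r + 2 + t) 2)"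
  by (rule pair_graph_pendant_split) simp

definition extremal :: "nat \<Rightarrow> ((nat + nat) + nat) pair_pre_digraph" where
  "extremal m = (if even m then pendant_split 1 ((m + 4) div 2) 2 else pendant_split 2 ((m + 5) div 2) 2)"

text \<open>Here \<open>r\<close> counts the common neighbours of the two dominating vertices and
  \<open>t\<close> the pendant vertices, which turns the halved index into
  \<open>r + 2 + t\<close>.\<close>

lemma extremal_eq:
  assumes "m \<ge> 22"
  obtains r t where "m = 2 * r + t + 1" "even m \<longleftrightarrow> t = 1" "odd m \<longleftrightarrow> t = 2" "r \<ge> 2"
    "extremal m = pendant_split t (r + 2 + t) 2"
proof (cases "even m")
  case True
  then obtain k where k: "m = 2 * k" by blast
  have "m = 2 * (k - 1) + 1 + 1" "(m + 4) div 2 = (k - 1) + 2 + 1" "k - 1 \<ge> 2" using k assms by auto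
  moreover from this True have "extremal m = pendant_split 1 (k - 1 + 2 + 1) 2"
    by (simp only: extremal_def if_True)
  ultimately show thesis using that[of "k - 1" 1] True by simp
next
  case False
  then obtain k where k: "m = 2 * k + 1" by (blast elim: oddE)
  have "m = 2 * (k - 1) + 2 + 1" "(m + 5) div 2 = (k - 1) + 2 + 2" "k - 1 \<ge> 2" using k assms by auto
  moreover from this False have "extremal m = pendant_split 2 (k - 1 + 2 + 2) 2"
    by (simp only: extremal_def if_False)
  ultimately show thesis using that[of "k - 1" 2] False by simp
qed

text \<open>By \<open>psi1_pendant\<close>, \<open>rho1 m\<close> is a root of the quartic of the
  extremal graph and hence one of its eigenvalues.\<close>

lemma rho1_le_of_iso_extremal:
  assumes m: "m \<ge> 22" and G: "pair_graph G" and iso: "graph_iso G (extremal m)"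
  shows "rho1 m \<le> largest_eigenvalue G"
proof -
  obtain r t where rt: "m = 2 * r + t + 1" "even m \<longleftrightarrow> t = 1" "odd m \<longleftrightarrow> t = 2" "r \<ge> 2"
    and X: "extremal m = pendant_split t (r + 2 + t) 2" using extremal_eq[OF m] .
  obtain u c L I where f: "pendant_form (pverts (extremal m)) (parcs (extremal m)) u c L I"
    and card: "card L = r" "card I = t"
    unfolding X by (rule pendant_form_pendant_split[OF rt(4)])
  have "rho1 m > 0" using rho1_bounds(1)[OF m order_refl] by simp
  moreover have "((rho1 m)\<^sup>2 - card L - card I) * ((rho1 m)\<^sup>2 - card L) = (rho1 m + card L)\<^sup>2"
    using psi1_rho1[OF m] psi1_pendant[OF rt(1-3)] card by simp
  ultimately obtain z where z: "z u = 1"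
    "\<And>v. v \<in> pverts (extremal m) \<Longrightarrow> (\<Sum>y \<in> nbrs (pverts (extremal m)) (parcs (extremal m)) v. z y) = rho1 m * z v"
    by (rule pendant_form_eigenvector[OF f]) blast
  show ?thesis
  proof (rule eigenvalue_iso[OF G _ iso _ _ z(2)])
    show "pair_graph (extremal m)" unfolding X by (rule pair_graph_pendant_split_sum[OF rt(4)])
    show "u \<in> pverts (extremal m)" using f by (auto simp: pendant_form_def)
  qed (use z in auto)
qed

text \<open>\<open>pendant_structure\<close> leaves only the number \<open>card I\<close> of pendant
  vertices open. More than \<open>t\<close> of them would make \<open>psi1 m l\<close> negative and
  so \<open>l < rho1 m\<close>; none gives the excluded split graph; parity leaves
  \<open>card I = t\<close>.\<close>

lemma extremal_of_large_eigenvalue: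
  assumes m: "m \<ge> 22" and G: "pair_graph G" and edges: "card (edges G) = m"
    and iso0: "\<nexists>v. isolated G v"
    and c5: "\<not> contains_subgraph_iso_to G (cycle_graph 5)"
    and split: "odd m \<longrightarrow> \<not> graph_iso G (complete_split ((m + 3) div 2) 2)"
    and ge: "largest_eigenvalue G \<ge> rho1 m"
  shows "graph_iso G (extremal m)" "largest_eigenvalue G \<le> rho1 m"
proof -
  define l where "l = largest_eigenvalue G"
  note g = pair_graph_facts[OF G]
  note b = rho1_bounds[OF m ge, folded l_def]
  have cE: "card (parcs G) = 2 * m" using card_parcs[OF G] edges by simp
  then have "parcs G \<noteq> {}" using m by auto
  then have "pverts G \<noteq> {}" using g(4) by auto
  then obtain x u where u: "u \<in> pverts G" "x u = 1"
    and x: "\<And>v. v \<in> pverts G \<Longrightarrow> 0 \<le> x v \<and> x v \<le> (1::real)"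
    "\<And>v. v \<in> pverts G \<Longrightarrow> (\<Sum>y \<in> nbrs (pverts G) (parcs G) v. x y) = l * x v"
    unfolding l_def by (rule perron_vector[OF G]) blast
  interpret c5_free_perron "pverts G" "parcs G" x l u m
  proof
    show "nbrs (pverts G) (parcs G) v \<noteq> {}" if v: "v \<in> pverts G" for v
    proof
      assume "nbrs (pverts G) (parcs G) v = {}"
      then have "out_arcs (with_proj G) v = {}" using g(4) by (auto simp: out_arcs_def nbrs_def)
      then have "isolated G v" using v by (simp add: isolated_def out_degree_def)
      then show False using iso0 by blast
    qed
    show "\<not> distinct [a0, a1, a2, a3, a4]"
      if "(a0, a1) \<in> parcs G" "(a1, a2) \<in> parcs G" "(a2, a3) \<in> parcs G" "(a3, a4) \<in> parcs G" "(a4, a0) \<in> parcs G"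
      for a0 a1 a2 a3 a4
      using contains_c5[OF G that] c5 by blast
  qed (use g cE u x b in auto)
  obtain c L I where f: "pendant_form (pverts G) (parcs G) u c L I" and "L \<noteq> {}"
    and mLI: "m = 2 * card L + card I + 1"
    and root: "(l\<^sup>2 - card L - card I) * (l\<^sup>2 - card L) = (l + card L)\<^sup>2"
    using pendant_structure[OF b(3)] .
  note psi = psi1_diff[OF mLI root]
  have psi0: "\<not> psi1 m l < 0" using less_rho1[OF m, of l] ge by (auto simp: l_def)
  obtain r t where rt: "m = 2 * r + t + 1" "even m \<longleftrightarrow> t = 1" "odd m \<longleftrightarrow> t = 2" "r \<ge> 2"
    and X: "extremal m = pendant_split t (r + 2 + t) 2" using extremal_eq[OF m] .
  have "card I \<le> t"
  proof (rule ccontr)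
    assume I: "\<not> card I \<le> t"
    have "psi1 m l < 0"
    proof (cases "even m")
      case True
      then show ?thesis unfolding psi using I rt b(1) by (auto intro!: mult_neg_pos)
    next
      case False
      then show ?thesis unfolding psi using I rt b(1) by (auto intro!: mult_neg_pos)
    qed
    then show False using psi0 by simp
  qed
  moreover have "card I \<noteq> 0"
  proof
    assume I: "card I = 0"
    then have "odd m" "(m + 3) div 2 = card L + 2" using mLI by auto
    have "graph_iso G (complete_split (card L + 2) 2)"
      by (rule pendant_form_iso[OF G pair_graph_complete_split f pendant_form_complete_split])
        (simp_all add: card_image I)
    with \<open>odd m\<close> \<open>(m + 3) div 2 = card L + 2\<close> show False using split by simp
  qed
  moreover have "even (card I) \<longleftrightarrow> even t" using mLI rt(1) by presburger
  moreover have "t = 1 \<or> t = 2" using rt by blast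
  ultimately have I: "card I = t" by (auto simp: le_Suc_eq numeral_2_eq_2)
  then have L: "card L = r" using mLI rt(1) by simp
  obtain u' c' L' I' where f': "pendant_form (pverts (extremal m)) (parcs (extremal m)) u' c' L' I'"
    and card: "card L' = r" "card I' = t"
    unfolding X by (rule pendant_form_pendant_split[OF rt(4)])
  show "graph_iso G (extremal m)"
    by (rule pendant_form_iso[OF G _ f f'])
      (use card I L pair_graph_pendant_split_sum[OF rt(4)] X in simp_all)
  \<comment> \<open>With \<open>card I = t\<close> the factor \<open>1 - t\<close> or
    \<open>2 - t\<close> in \<open>psi1_diff\<close> vanishes.\<close>
  have "psi1 m l = 0" unfolding psi using I rt(2,3) by auto
  then show "largest_eigenvalue G \<le> rho1 m" using le_rho1 by (simp add: l_def)
qed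

theorem theorem1p3:
  fixes G :: "'a pair_pre_digraph" and m :: nat
  assumes "m \<ge> 22"
    and "pair_graph G"
    and "card (edges G) = m"
    and "\<nexists>v. isolated G v"
    and "\<not> contains_subgraph_iso_to G (cycle_graph 5)"
    and "odd m \<longrightarrow> \<not> graph_iso G (complete_split ((m + 3) div 2) 2)"
  shows "largest_eigenvalue G \<le> rho1 m \<and>
    (largest_eigenvalue G = rho1 m \<longleftrightarrow>
      (if even m then graph_iso G (pendant_split 1 ((m + 4) div 2) 2)
       else graph_iso G (pendant_split 2 ((m + 5) div 2) 2)))"
proof -
  note ex = extremal_of_large_eigenvalue[OF assms]
  \<comment> \<open>The facts \<open>ex\<close> presuppose
    \<open>largest_eigenvalue G \<ge> rho1 m\<close>; in the opposite case the inequality is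
    immediate.\<close>
  have le: "largest_eigenvalue G \<le> rho1 m" using ex(2) by linarith
  moreover have "largest_eigenvalue G = rho1 m \<longleftrightarrow> graph_iso G (extremal m)"
    using ex(1) rho1_le_of_iso_extremal[OF assms(1,2)] le by fastforce
  ultimately show ?thesis by (simp add: extremal_def)
qed

end
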